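(* Let $S$ be a monoid. In each of the following eight cases, if every word in the set $W$ is an isoterm for $S$ and $S$ satisfies the identity $\mathbf U_n\approx\mathbf V_n$ for every $n>1$, then $S$ is non-finitely based. (All letters denote distinct variables; $[Xn]=x_1x_2\cdots x_n$, $[nX]=x_nx_{n-1}\cdots x_1$, and similarly for other letters.) 1. $W=\{xyyx\}$; $\ xx[Yn][nY]\approx[Yn][nY]xx$. 2. $W=\{yxxty,\ ytxxy\}$; $\ z_1t_1z_2t_2\cdots z_nt_n\,yxx\,[Zn]\,y\approx z_1t_1z_2t_2\cdots z_nt_n\,xxy\,[Zn]\,y$. 3. $W=\{xt_1xyt_2y\}$; $\ \mathbf A\,x\,\mathbf B\,xy\,\mathbf C\,y\,\mathbf D\approx\mathbf A\,x\,\mathbf B\,yx\,\mathbf C\,y\,\mathbf D$, where $\mathbf A=z_1tp_1tz_2tp_2t\cdots z_ntp_nt$, $\mathbf B=z_1q_1z_2q_2\cdots z_nq_n$, $\mathbf C=p_1r_1p_2r_2\cdots p_nr_n$, $\mathbf D=tq_1tr_1tq_2tr_2\cdots tq_ntr_n$, and each displayed occurrence of $t$ is a different linear variable. 4. $W=\{xxyy,\ xyt_1yt_2x\}$; $\ xyty\,z_1^2z_2^2\cdots z_n^2\,x\approx yxty\,z_1^2z_2^2\cdots z_n^2\,x$. 5. $W=\{xt_1yxt_2y,\ xytxy,\ xytyx\}$; $\ xy[Zn]yxt[nZ]\approx yx[Zn]xyt[nZ]$. 6. $W=\{xt_1yxt_2y,\ xytxy,\ xytyx\}$; $\ xy[Zn]xyt[nZ]\approx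 yx[Zn]yxt[nZ]$. 7. $W=\{xt_1xyt_2y,\ xyyx\}$; $\ [Xn][nX][Yn][nY]\approx[Yn][nY][Xn][nX]$. 8. For a fixed integer $m>2$: $W=\{xxyy\}\cup\{yt_1yx^dt_2x^{m-d},\ x^{m-d}t_1x^dyt_2y: 0<d<m\}$; $\ yt_1x^{m-1}y\,p_1^2\cdots p_n^2\,zxt_2z\approx yt_1x^my\,p_1^2\cdots p_n^2\,zt_2z$.
   Context: Words are elements of the free semigroup over a countably infinite alphabet of variables. A monoid $S$ satisfies an identity $\mathbf u\approx\mathbf v$ if both sides are equal under every evaluation of the variables in $S$. A word $\mathbf w$ is an isoterm for $S$ if $S$ satisfies no identity $\mathbf w\approx\mathbf w'$ with $\mathbf w'\ne\mathbf w$. $S$ is finitely based if all identities of $S$ are derivable from a finite subset of them; otherwise non-finitely based. A variable is linear in a word if it occurs exactly once. *)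

theory Defs
  imports Main "HOL-Library.Nat_Bijection"
begin

text \<open>Variables are natural numbers; words are lists of variables (nonempty for
 words of the free semigroup). A monoid S is modelled as a type of class monoid_mult.\<close>

type_synonym word = "nat list"

definition eval_word :: "(nat \<Rightarrow> 'a::monoid_mult) \<Rightarrow> word \<Rightarrow> 'a" where
  "eval_word \<phi> w = prod_list (map \<phi> w)"

definition satisfies :: "'a::monoid_mult itself \<Rightarrow> word \<Rightarrow> word \<Rightarrow> bool" where
  "satisfies S u v \<longleftrightarrow> (\<forall>\<phi> :: nat \<Rightarrow> 'a. eval_word \<phi> u = eval_word \<phi> v)"

definition isoterm :: "'a::monoid_mult itself \<Rightarrow> word \<Rightarrow> bool" where
  "isoterm S w \<longleftrightarrow> (\<forall>w'. w' \<noteq> [] \<and> satisfies S w w' \<longrightarrow> w' = w)"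

definition identities :: "'a::monoid_mult itself \<Rightarrow> (word \<times> word) set" where
  "identities S = {(u, v). u \<noteq> [] \<and> v \<noteq> [] \<and> satisfies S u v}"

definition subst :: "(nat \<Rightarrow> word) \<Rightarrow> word \<Rightarrow> word" where
  "subst \<sigma> w = concat (map \<sigma> w)"

definition ded_step :: "(word \<times> word) set \<Rightarrow> word \<Rightarrow> word \<Rightarrow> bool" where
  "ded_step \<Sigma> w w' \<longleftrightarrow> (\<exists>a b \<sigma> s t. ((s, t) \<in> \<Sigma> \<or> (t, s) \<in> \<Sigma>) \<and>
      w = a @ subst \<sigma> s @ b \<and> w' = a @ subst \<sigma> t @ b)"

definition derivable :: "(word \<times> word) set \<Rightarrow> word \<Rightarrow> word \<Rightarrow> bool" where
  "derivable \<Sigma> u v \<longleftrightarrow> (ded_step \<Sigma>)\<^sup>*\<^sup>* u v"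

definition finitely_based :: "'a::monoid_mult itself \<Rightarrow> bool" where
  "finitely_based S \<longleftrightarrow> (\<exists>\<Sigma>. finite \<Sigma> \<and> \<Sigma> \<subseteq> identities S \<and>
      (\<forall>(u, v) \<in> identities S. derivable \<Sigma> u v))"

definition var :: "nat \<Rightarrow> nat \<Rightarrow> nat" where "var k i = prod_encode (k, i)"

abbreviation "vx \<equiv> var 0 0"
abbreviation "vy \<equiv> var 1 0"
abbreviation "vt \<equiv> var 2 0"
abbreviation "vt1 \<equiv> var 2 1"
abbreviation "vt2 \<equiv> var 2 2"
abbreviation "vz \<equiv> var 2 3"
abbreviation "zs i \<equiv> var 3 i"
abbreviation "ps i \<equiv> var 4 i"
abbreviation "qs i \<equiv> var 5 i"
abbreviation "rs i \<equiv> var 6 i"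
abbreviation "xs i \<equiv> var 7 i"
abbreviation "ys i \<equiv> var 8 i"
abbreviation "ts i \<equiv> var 9 i"   \<comment> \<open>t_i (indexed, and the linear t's of case 3)\<close>

definition up :: "(nat \<Rightarrow> nat) \<Rightarrow> nat \<Rightarrow> word" where "up f n = map f [1..<n+1]"
definition down :: "(nat \<Rightarrow> nat) \<Rightarrow> nat \<Rightarrow> word" where "down f n = rev (up f n)"

definition blocks :: "(nat \<Rightarrow> word) \<Rightarrow> nat \<Rightarrow> word" where
  "blocks f n = concat (map f [1..<n+1])"

definition W1 :: "word set" where "W1 = {[vx, vy, vy, vx]}"
definition U1 :: "nat \<Rightarrow> word" where "U1 n = [vx, vx] @ up ys n @ down ys n"
definition V1 :: "nat \<Rightarrow> word" where "V1 n = up ys n @ down ys n @ [vx, vx]"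

definition W2 :: "word set" where "W2 = {[vy, vx, vx, vt, vy], [vy, vt, vx, vx, vy]}"
definition U2 :: "nat \<Rightarrow> word" where
  "U2 n = blocks (\<lambda>i. [zs i, ts i]) n @ [vy, vx, vx] @ up zs n @ [vy]"
definition V2 :: "nat \<Rightarrow> word" where
  "V2 n = blocks (\<lambda>i. [zs i, ts i]) n @ [vx, vx, vy] @ up zs n @ [vy]"

definition W3 :: "word set" where "W3 = {[vx, vt1, vx, vy, vt2, vy]}"
definition A3 :: "nat \<Rightarrow> word" where
  "A3 n = blocks (\<lambda>i. [zs i, ts (4*i), ps i, ts (4*i+1)]) n"
definition B3 :: "nat \<Rightarrow> word" where "B3 n = blocks (\<lambda>i. [zs i, qs i]) n"
definition C3 :: "nat \<Rightarrow> word" where "C3 n = blocks (\<lambda>i. [ps i, rs i]) n"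
definition D3 :: "nat \<Rightarrow> word" where
  "D3 n = blocks (\<lambda>i. [ts (4*i+2), qs i, ts (4*i+3), rs i]) n"
definition U3 :: "nat \<Rightarrow> word" where
  "U3 n = A3 n @ [vx] @ B3 n @ [vx, vy] @ C3 n @ [vy] @ D3 n"
definition V3 :: "nat \<Rightarrow> word" where
  "V3 n = A3 n @ [vx] @ B3 n @ [vy, vx] @ C3 n @ [vy] @ D3 n"

definition W4 :: "word set" where "W4 = {[vx, vx, vy, vy], [vx, vy, vt1, vy, vt2, vx]}"
definition U4 :: "nat \<Rightarrow> word" where
  "U4 n = [vx, vy, vt, vy] @ blocks (\<lambda>i. [zs i, zs i]) n @ [vx]"
definition V4 :: "nat \<Rightarrow> word" where
  "V4 n = [vy, vx, vt, vy] @ blocks (\<lambda>i. [zs i, zs i]) n @ [vx]"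

definition W56 :: "word set" where
  "W56 = {[vx, vt1, vy, vx, vt2, vy], [vx, vy, vt, vx, vy], [vx, vy, vt, vy, vx]}"
definition U5 :: "nat \<Rightarrow> word" where
  "U5 n = [vx, vy] @ up zs n @ [vy, vx, vt] @ down zs n"
definition V5 :: "nat \<Rightarrow> word" where
  "V5 n = [vy, vx] @ up zs n @ [vx, vy, vt] @ down zs n"
definition U6 :: "nat \<Rightarrow> word" where
  "U6 n = [vx, vy] @ up zs n @ [vx, vy, vt] @ down zs n"
definition V6 :: "nat \<Rightarrow> word" where
  "V6 n = [vy, vx] @ up zs n @ [vy, vx, vt] @ down zs n"

definition W7 :: "word set" where "W7 = {[vx, vt1, vx, vy, vt2, vy], [vx, vy, vy, vx]}"
definition U7 :: "nat \<Rightarrow> word" where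
  "U7 n = up xs n @ down xs n @ up ys n @ down ys n"
definition V7 :: "nat \<Rightarrow> word" where
  "V7 n = up ys n @ down ys n @ up xs n @ down xs n"

definition W8 :: "nat \<Rightarrow> word set" where
  "W8 m = {[vx, vx, vy, vy]}
     \<union> {[vy, vt1, vy] @ replicate d vx @ [vt2] @ replicate (m - d) vx | d. 0 < d \<and> d < m}
     \<union> {replicate (m - d) vx @ [vt1] @ replicate d vx @ [vy, vt2, vy] | d. 0 < d \<and> d < m}"
definition U8 :: "nat \<Rightarrow> nat \<Rightarrow> word" where
  "U8 m n = [vy, vt1] @ replicate (m - 1) vx @ [vy] @ blocks (\<lambda>i. [ps i, ps i]) n
            @ [vz, vx, vt2, vz]"
definition V8 :: "nat \<Rightarrow> nat \<Rightarrow> word" where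
  "V8 m n = [vy, vt1] @ replicate m vx @ [vy] @ blocks (\<lambda>i. [ps i, ps i]) n
            @ [vz, vt2, vz]"

definition hyp :: "'a::monoid_mult itself \<Rightarrow> word set \<Rightarrow> (nat \<Rightarrow> word) \<Rightarrow> (nat \<Rightarrow> word) \<Rightarrow> bool" where
  "hyp S W U V \<longleftrightarrow> (\<forall>w\<in>W. isoterm S w) \<and> (\<forall>n>1. satisfies S (U n) (V n))"

end

theory Submission
  imports Defs
begin

text \<open>
  A word is determined by its projections to pairs of adjacent letters, and an identity of the
  monoid survives deletion of letters. Hence the isoterms in \<open>W\<close> control how much of a word can
  change under an identity.

  Suppose that all identities in a finite basis have length at most \<open>N\<close>. In a long word with more
  than \<open>N + 1\<close> two-letter factors that occur only once, one deduction step cannot separate all of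
  these factors: a new letter \<open>T\<close> can be inserted in the middle of at least one of them such that
  the step is still an instance of the same identity. The additional linear letter turns
  projections of the word that need not be isoterms into isoterms. So some feature of \<open>U n\<close>
  survives every step if \<open>n\<close> is large, while \<open>V n\<close> lacks it. In cases 3, 5, 6 and 7 the word
  \<open>U n\<close> itself is preserved, since it becomes an isoterm after inserting one or two new letters.
\<close>

section \<open>Identities of a monoid and isoterms\<close>

text \<open>The obstacle is that \<open>U n\<close> equals \<open>V n\<close> in \<open>S\<close>,
  so \<open>U n\<close> is no isoterm, and a derivation may pass through any word equal to
  \<open>U n\<close> in \<open>S\<close>. The bound \<open>N + 1\<close> counts the boundaries
  inside one step: a side of length at most \<open>N\<close> has at most \<open>N\<close> images of
  letters, hence at most \<open>N + 1\<close> end points. \<open>T\<close> can be carried to the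
  other side of the step because linearity of a letter is preserved by the identities of
  \<open>S\<close>. In Cases 3, 5, 6, 7 the invariant is the word itself, so the factors to be cut
  are known in advance. In Cases 1, 2, 4, 8 it is weaker: a few stray letters (the
  \<open>vx\<close>, in Case 2 also the \<open>vy\<close>) may sit anywhere. Removing them leaves a
  word with enough cuttable factors, and each stray letter spoils at most one of these. This is the
  origin of the offsets 4 = 2 + 2 in Cases 1 and 4, 6 = 4 + 2 in Case 2, and m + 2 in Case 8. The
  invariant is chosen so that it tells on which side of \<open>T\<close> the stray letters lie; an
  isoterm containing \<open>T\<close> then keeps them there.\<close>

abbreviation proj :: "'b set \<Rightarrow> 'b list \<Rightarrow> 'b list" where
  "proj X w \<equiv> filter (\<lambda>v. v \<in> X) w"

lemma var_eq_iff [simp]: "var k i = var l j \<longleftrightarrow> k = l \<and> i = j"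
  by (simp add: var_def)

lemma filter_eq_notin [simp]: "a \<notin> set w \<Longrightarrow> filter (\<lambda>v. v = a) w = []"
  by (auto simp: filter_empty_conv)

lemma eval_word_simps [simp]:
  "eval_word \<phi> [] = 1"
  "eval_word \<phi> (v # w) = \<phi> v * eval_word \<phi> w"
  "eval_word \<phi> (u @ w) = eval_word \<phi> u * eval_word \<phi> w"
  by (simp_all add: eval_word_def)

lemma subst_simps [simp]:
  "subst \<sigma> [] = []"
  "subst \<sigma> (v # w) = \<sigma> v @ subst \<sigma> w"
  "subst \<sigma> (u @ w) = subst \<sigma> u @ subst \<sigma> w"
  by (simp_all add: subst_def)

lemma subst_fun_upd_notin [simp]: "v \<notin> set w \<Longrightarrow> subst (\<sigma>(v := z)) w = subst \<sigma> w"
  by (induction w) auto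

lemma eval_word_subst: "eval_word \<phi> (subst \<sigma> w) = eval_word (\<lambda>v. eval_word \<phi> (\<sigma> v)) w"
  by (induction w) auto

text \<open>Since \<open>S\<close> has a unit, letters may be replaced by the empty word. Deletion
  of letters thus becomes a substitution and preserves identities.\<close>

lemma filter_eq_subst: "filter Q w = subst (\<lambda>v. if Q v then [v] else []) w"
  by (induction w) auto

lemma map_eq_subst: "map f w = subst (\<lambda>v. [f v]) w"
  by (induction w) auto

lemma satisfies_refl: "satisfies S u u"
  by (simp add: satisfies_def)

lemma satisfies_sym: "satisfies S u v \<Longrightarrow> satisfies S v u"
  by (simp add: satisfies_def)

lemma satisfies_trans: "satisfies S u v \<Longrightarrow> satisfies S v w \<Longrightarrow> satisfies S u w"
  by (simp add: satisfies_def)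

lemma satisfies_append: "satisfies S u v \<Longrightarrow> satisfies S u' v' \<Longrightarrow> satisfies S (u @ u') (v @ v')"
  by (simp add: satisfies_def)

lemma satisfies_subst: "satisfies S u v \<Longrightarrow> satisfies S (subst \<sigma> u) (subst \<sigma> v)"
  by (simp add: satisfies_def eval_word_subst)

lemma satisfies_filter: "satisfies S u v \<Longrightarrow> satisfies S (filter Q u) (filter Q v)"
  by (simp add: filter_eq_subst satisfies_subst)

lemma satisfies_map: "satisfies S u v \<Longrightarrow> satisfies S (map f u) (map f v)"
  by (simp add: map_eq_subst satisfies_subst)

text \<open>The definition of an isoterm only compares with nonempty words. The empty word is
  excluded by hand: if \<open>u\<close> equals 1 in \<open>S\<close>, then it also equals
  \<open>u @ u\<close>, which is nonempty and different from \<open>u\<close> unless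
  \<open>u\<close> is empty.\<close>

lemma isotermD:
  assumes "isoterm S u" "satisfies S u v"
  shows "v = u"
proof (cases "v = []")
  case True
  have "satisfies S u (u @ u)"
    using assms(2) True by (simp add: satisfies_def)
  then show ?thesis
    using assms True unfolding isoterm_def by (metis append_self_conv append_is_Nil_conv)
next
  case False
  then show ?thesis using assms by (auto simp: isoterm_def)
qed

lemma isotermI: "(\<And>v. satisfies S u v \<Longrightarrow> v = u) \<Longrightarrow> isoterm S u"
  by (auto simp: isoterm_def)

lemma isoterm_factor: "isoterm S (a @ u @ b) \<Longrightarrow> isoterm S u"
proof (rule isotermI)
  fix v assume iso: "isoterm S (a @ u @ b)" and "satisfies S u v"
  then have "satisfies S (a @ u @ b) (a @ v @ b)"
    by (intro satisfies_append satisfies_refl)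
  with iso show "v = u" using isotermD by fastforce
qed

lemma isoterm_proj:
  "satisfies S u v \<Longrightarrow> isoterm S (proj X u) \<Longrightarrow> proj X v = proj X u"
  using isotermD satisfies_filter by blast

text \<open>The form used to exclude configurations: an isoterm that shows up as a projection of a
  derived word must already be a projection of the original word.\<close>

lemma isoterm_proj_right:
  "satisfies S u v \<Longrightarrow> isoterm S (proj X v) \<Longrightarrow> proj X v = proj X u"
  using isoterm_proj satisfies_sym by metis

text \<open>The minimal nontriviality of \<open>S\<close> used throughout: it makes the set of
  letters of a word, and the property of a letter to be linear in it, invariant under identities of
  \<open>S\<close>.\<close>

definition lin :: "'a::monoid_mult itself \<Rightarrow> bool" where
  "lin S \<longleftrightarrow> (\<forall>a. isoterm S [a])"

text \<open>Let \<open>a\<close> be the first letter of \<open>u\<close>. Identifying all letters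
  with \<open>a\<close> shows that a word equal to \<open>[b]\<close> has length one. If it were
  another letter, deleting \<open>b\<close> would give that \<open>a\<close> equals 1, hence
  \<open>[a]\<close> equals \<open>[a, a]\<close>, against the isoterm \<open>[a]\<close>.\<close>

lemma isoterm_lin:
  assumes "isoterm S u" "u \<noteq> []"
  shows "lin S"
  unfolding lin_def
proof (intro allI isotermI)
  fix b v assume sat: "satisfies S [b] v"
  let ?a = "hd u"
  have isoa: "isoterm S [?a]"
    using isoterm_factor[of S "[]" "[?a]" "tl u"] assms by simp
  have "satisfies S [?a] (map (\<lambda>_. ?a) v)"
    using satisfies_map[OF sat, of "\<lambda>_. ?a"] by simp
  then have "map (\<lambda>_. ?a) v = [?a]" by (rule isotermD[OF isoa])
  then obtain c where v: "v = [c]" by (cases v) auto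
  show "v = [b]"
  proof (rule ccontr)
    assume "v \<noteq> [b]"
    then have "satisfies S [] [?a]"
      using satisfies_subst[OF sat, of "(\<lambda>_. [?a])(b := [])"] v by simp
    then have "satisfies S [?a] [?a, ?a]"
      using satisfies_append[OF satisfies_refl[of S "[?a]"], of "[]" "[?a]"] by simp
    then show False using isotermD[OF isoa] by fastforce
  qed
qed

text \<open>A letter \<open>a\<close> on one side only would, after deletion of all others, give
  that a positive power of \<open>a\<close> equals 1. Multiplying by \<open>a\<close> contradicts
  the isoterm \<open>[a]\<close>.\<close>

lemma satisfies_set:
  assumes "lin S" "satisfies S u v"
  shows "set v = set u"
proof -
  have *: "set u \<subseteq> set v" if sat: "satisfies S u v" for u v
  proof (rule subsetI, rule ccontr)
    fix a assume a: "a \<in> set u" "a \<notin> set v"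
    have "satisfies S (proj {a} u) (proj {a} v)"
      using sat by (rule satisfies_filter)
    moreover have "proj {a} v = []"
      using a(2) by (auto simp: filter_empty_conv)
    ultimately have "satisfies S [a] (a # proj {a} u)"
      by (simp add: satisfies_def)
    then have "proj {a} u = []"
      using assms(1) isotermD unfolding lin_def by fastforce
    then show False using a(1) by (auto simp: filter_empty_conv)
  qed
  show ?thesis using *[OF assms(2)] *[OF satisfies_sym[OF assms(2)]] by blast
qed

text \<open>The renaming is injective on the letters of \<open>u\<close> only. This is enough,
  because a word equal to the renamed one contains no further letters and can be pulled
  back.\<close>

lemma isoterm_map:
  assumes "isoterm S u" "inj_on f (set u)"
  shows "isoterm S (map f u)"
proof (cases "u = []")
  case False
  show ?thesis
  proof (rule isotermI)
    fix v assume sat: "satisfies S (map f u) v"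
    have lin: "lin S" using assms(1) False by (rule isoterm_lin)
    let ?g = "inv_into (set u) f"
    have set: "set v = f ` set u" using satisfies_set[OF lin sat] by simp
    have "map ?g (map f u) = u"
      using assms(2) by (simp add: map_idI)
    then have "map ?g v = u"
      using satisfies_map[OF sat, of ?g] isotermD[OF assms(1)] by metis
    moreover have "map f (map ?g v) = v"
      using set by (auto intro!: map_idI simp: f_inv_into_f)
    ultimately show "v = map f u" by metis
  qed
qed (use assms in simp)

lemma satisfies_linear:
  assumes "lin S" "satisfies S u v" "u = u1 @ a # u2" "a \<notin> set u1" "a \<notin> set u2"
  obtains v1 v2 where "v = v1 @ a # v2" "a \<notin> set v1" "a \<notin> set v2"
proof -
  have "proj {a} u = [a]" using assms(3-5) by simp
  then have p: "proj {a} v = [a]"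
    using assms(1,2) isoterm_proj unfolding lin_def by metis
  then have "a \<in> set (proj {a} v)" by simp
  then have "a \<in> set v" by auto
  then obtain v1 v2 where "v = v1 @ a # v2" "a \<notin> set v1"
    by (meson split_list_first)
  with p have "a \<notin> set v2" by (auto simp: filter_empty_conv)
  with \<open>v = v1 @ a # v2\<close> \<open>a \<notin> set v1\<close> show ?thesis using that by blast
qed

section \<open>Words and their projections to adjacent letters\<close>

text \<open>Equal first letters are removed by induction. Otherwise let \<open>b\<close> be the
  first letter of \<open>w\<close>, and consider the letter just before the first \<open>b\<close>
  in the other word. Some common projection keeps both. In \<open>w\<close> it begins with
  \<open>b\<close>, but in the other word it begins with a letter standing before the first
  \<open>b\<close>.\<close>

lemma eq_if_adjacent_proj_eq_aux:
  assumes "successively (\<lambda>c d. \<exists>X. c \<in> X \<and> d \<in> X \<and> proj X u = proj X w) u"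
    and "\<And>a. proj {a} u = proj {a} w"
  shows "w = u"
  using assms
proof (induction u arbitrary: w)
  case Nil
  have "proj {hd w} w = []" using Nil.prems(2) by (metis filter.simps(1))
  then show ?case by (cases w) auto
next
  case (Cons a u)
  obtain b w' where w: "w = b # w'"
    using Cons.prems(2)[of a] by (cases w) auto
  show ?case
  proof (cases "a = b")
    case True
    have "proj {c} u = proj {c} w'" for c
      using Cons.prems(2)[of c] True w by (cases "c = b") auto
    moreover have "successively (\<lambda>c d. \<exists>X. c \<in> X \<and> d \<in> X \<and> proj X (a # u) = proj X w) u"
      using Cons.prems(1) by (cases u) (simp_all only: successively.simps)
    then have "successively (\<lambda>c d. \<exists>X. c \<in> X \<and> d \<in> X \<and> proj X u = proj X w') u"
      by (rule successively_mono) (use w True in \<open>auto split: if_splits; blast\<close>)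
    ultimately show ?thesis using Cons.IH w True by blast
  next
    case False
    have "b \<in> set (a # u)"
    proof (rule ccontr)
      assume "\<not> ?thesis"
      then have "proj {b} (a # u) = []" by (auto simp: filter_empty_conv)
      with Cons.prems(2)[of b] w show False by auto
    qed
    then obtain us vs where split: "a # u = us @ b # vs" "b \<notin> set us"
      by (meson split_list_first)
    have us: "us \<noteq> []" using split False by auto
    define R where "R = (\<lambda>c d. \<exists>X. c \<in> X \<and> d \<in> X \<and> proj X (a # u) = proj X w)"
    have "successively R (a # u)"
      using Cons.prems(1) unfolding R_def .
    then have "R (last us) b"
      using us by (simp only: split(1) successively_append_iff list.sel) simp
    then obtain X where X: "last us \<in> X" "b \<in> X" "proj X (a # u) = proj X w"
      unfolding R_def by blast
    have ne: "proj X us \<noteq> []"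
      using us X(1) by (auto simp: filter_empty_conv intro!: bexI[of _ "last us"])
    then have "hd (proj X (a # u)) \<in> set (proj X us)"
      using split(1) by (metis filter_append hd_append2 hd_in_set)
    moreover have "hd (proj X w) = b" using w X(2) by simp
    ultimately show ?thesis using X(3) split(2) by auto
  qed
qed

lemma successively_neighbour:
  "successively R u \<Longrightarrow> 2 \<le> length u \<Longrightarrow> a \<in> set u \<Longrightarrow> \<exists>b. R a b \<or> R b a"
proof (induction u rule: induct_list012)
  case (3 x y zs)
  then show ?case by (cases zs) auto
qed auto

text \<open>In a word of length at least two every letter has a neighbour, so the projection to a
  single letter is obtained from one of the given projections by deleting more.\<close>

lemma eq_if_adjacent_proj_eq:
  assumes succ: "successively (\<lambda>c d. \<exists>X. c \<in> X \<and> d \<in> X \<and> proj X u = proj X w) u"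
    and "set w \<subseteq> set u" "2 \<le> length u"
  shows "w = u"
proof (rule eq_if_adjacent_proj_eq_aux[OF succ])
  fix a
  show "proj {a} u = proj {a} w"
  proof (cases "a \<in> set u")
    case True
    then obtain X where "a \<in> X" "proj X u = proj X w"
      using successively_neighbour[OF succ assms(3) True] by blast
    then have "proj {a} (proj X u) = proj {a} (proj X w)" by simp
    moreover have "(\<lambda>v. v \<in> {a} \<and> v \<in> X) = (\<lambda>v. v \<in> {a})" using \<open>a \<in> X\<close> by auto
    ultimately show ?thesis by (simp only: filter_filter conj_commute)
  next
    case False
    then have "proj {a} u = []" "proj {a} w = []"
      using assms(2) by (auto simp: filter_empty_conv)
    then show ?thesis by (rule trans[OF _ sym])
  qed
qed

text \<open>The tool that builds long isoterms from short ones. The set \<open>X\<close> may be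
  larger than \<open>{c, d}\<close>: adding linear letters, in particular an inserted one, is what
  makes a projection an isoterm.\<close>

lemma isoterm_if_adjacent:
  assumes "successively (\<lambda>c d. \<exists>X. c \<in> X \<and> d \<in> X \<and> isoterm S (proj X u)) u"
    and "lin S" "2 \<le> length u"
  shows "isoterm S u"
proof (rule isotermI)
  fix v assume sat: "satisfies S u v"
  show "v = u"
  proof (rule eq_if_adjacent_proj_eq)
    show "successively (\<lambda>c d. \<exists>X. c \<in> X \<and> d \<in> X \<and> proj X u = proj X v) u"
      using assms(1) by (rule successively_mono) (use isoterm_proj[OF sat] in metis)
    show "set v \<subseteq> set u" using satisfies_set[OF assms(2) sat] by simp
  qed (rule assms(3))
qed

section \<open>Inserting a linear letter into a deduction step\<close>

text \<open>An occurrence is identified by the prefix before it. This also makes sense for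
  \<open>c = d\<close> and for overlapping occurrences, as needed for squares.\<close>

definition once :: "word \<Rightarrow> nat \<Rightarrow> nat \<Rightarrow> bool" where
  "once w c d \<longleftrightarrow> (\<exists>p q. w = p @ c # d # q) \<and>
     (\<forall>p q p' q'. w = p @ c # d # q \<longrightarrow> w = p' @ c # d # q' \<longrightarrow> p = p')"

definition adjs :: "'b list \<Rightarrow> ('b \<times> 'b) set" where
  "adjs w = {(c, d). \<exists>p q. w = p @ c # d # q}"

lemma adjsI: "w = p @ c # d # q \<Longrightarrow> (c, d) \<in> adjs w"
  by (auto simp: adjs_def)

text \<open>Two occurrences in \<open>w\<close> stay occurrences in the projection. They stay
  different, because the \<open>c\<close> of the earlier one is retained and lies in the prefix of
  the later one.\<close>

lemma onceI_proj:
  assumes "(c, d) \<in> adjs w" "c \<in> X" "d \<in> X"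
    and uniq: "\<And>p q p' q'. proj X w = p @ c # d # q \<Longrightarrow> proj X w = p' @ c # d # q' \<Longrightarrow> length p = length p'"
  shows "once w c d"
proof -
  have False if "w = p @ c # d # q" "w = p' @ c # d # q'" "length p < length p'" for p q p' q'
  proof -
    have "take (Suc (length p)) w = p @ [c]" using that(1) by simp
    moreover have "take (Suc (length p)) w = take (Suc (length p)) p'" using that(2,3) by simp
    ultimately have "p' = (p @ [c]) @ drop (Suc (length p)) p'" by (metis append_take_drop_id)
    then have "length (proj X p') \<ge> length (proj X (p @ [c]))"
      by (metis filter_append le_add1 length_append)
    then have "length (proj X p') > length (proj X p)" using assms(2) by simp
    moreover have "length (proj X p) = length (proj X p')"
      by (rule uniq[of _ "proj X q" _ "proj X q'"]) (use that(1) assms(2,3) in simp, use that(2) assms(2,3) in simp)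
    ultimately show False by simp
  qed
  then have "p = p'" if "w = p @ c # d # q" "w = p' @ c # d # q'" for p q p' q'
    using that by (metis append_eq_append_conv linorder_neqE_nat)
  then show ?thesis using assms(1) unfolding once_def adjs_def by blast
qed

lemma finite_adjs: "finite (adjs w)"
proof (rule finite_subset)
  show "adjs w \<subseteq> set w \<times> set w" by (auto simp: adjs_def)
qed simp

text \<open>Deleting a single letter creates at most one new adjacent pair, formed by its two former
  neighbours.\<close>

lemma card_adjs_filter_diff:
  "card (adjs (filter Q w) - adjs w) \<le> length (filter (\<lambda>v. \<not> Q v) w)"
proof (induction "length (filter (\<lambda>v. \<not> Q v) w)" arbitrary: w)
  case 0
  then have "filter Q w = w" by (auto simp: filter_empty_conv filter_id_conv)
  then show ?case by simp
next
  case (Suc k)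
  then have "\<exists>x\<in>set w. \<not> Q x"
    by (metis filter_False length_0_conv nat.distinct(1))
  then obtain u x v where w: "w = u @ x # v" and x: "\<not> Q x"
    by (meson split_list)
  let ?w = "u @ v"
  have k: "k = length (filter (\<lambda>v. \<not> Q v) ?w)" and f: "filter Q ?w = filter Q w"
    using Suc(2) w x by auto
  have "adjs ?w - adjs w \<subseteq> {(last u, hd v)}"
  proof (rule subrelI)
    fix c d assume "(c, d) \<in> adjs ?w - adjs w"
    then have "(c, d) \<in> adjs ?w" "(c, d) \<notin> adjs w" by auto
    then obtain p q where "u @ v = p @ c # d # q" by (auto simp: adjs_def)
    then consider r where "u = p @ c # d # r" | "u = p @ [c]" "v = d # q"
      | r where "v = r @ c # d # q"
      by (auto simp: append_eq_append_conv2 Cons_eq_append_conv append_eq_Cons_conv)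
    then show "(c, d) \<in> {(last u, hd v)}"
    proof cases
      case 1
      then show ?thesis using \<open>(c, d) \<notin> adjs w\<close> adjsI[of w p c d "r @ x # v"] w by simp
    next
      case 3
      then show ?thesis using \<open>(c, d) \<notin> adjs w\<close> adjsI[of w "u @ x # r" c d q] w by simp
    qed simp
  qed
  then have "card (adjs ?w - adjs w) \<le> 1"
    by (metis card_mono card.empty card.insert empty_iff finite.emptyI finite.insertI One_nat_def)
  moreover have "card (adjs (filter Q w) - adjs w)
      \<le> card ((adjs (filter Q w) - adjs ?w) \<union> (adjs ?w - adjs w))"
    by (intro card_mono) (auto simp: finite_adjs)
  moreover have "card ((adjs (filter Q w) - adjs ?w) \<union> (adjs ?w - adjs w))
      \<le> card (adjs (filter Q w) - adjs ?w) + card (adjs ?w - adjs w)"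
    by (rule card_Un_le)
  moreover have "card (adjs (filter Q w) - adjs ?w) \<le> k"
    using Suc(1)[OF k] k f by simp
  ultimately show ?case using Suc(2) by linarith
qed

text \<open>Factors are easy to find in a projection that is fixed by an isoterm. Putting the at
  most \<open>k\<close> deleted letters back breaks at most \<open>k\<close> of them.\<close>

lemma card_Int_adjs:
  assumes "F \<subseteq> adjs (filter Q w)" "length (filter (\<lambda>v. \<not> Q v) w) \<le> k"
  shows "card F \<le> card (F \<inter> adjs w) + k"
proof -
  have fin: "finite F" using assms(1) finite_adjs finite_subset by blast
  have "card F \<le> card (F \<inter> adjs w) + card (F - adjs w)"
    by (metis Int_Diff_Un card_Un_le)
  moreover have "card (F - adjs w) \<le> card (adjs (filter Q w) - adjs w)"
    using assms(1) by (intro card_mono) (auto simp: finite_adjs)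
  ultimately show ?thesis using card_adjs_filter_diff[of Q w] assms(2) by linarith
qed

definition basis :: "'a::monoid_mult itself \<Rightarrow> (word \<times> word) set \<Rightarrow> nat \<Rightarrow> bool" where
  "basis S \<Sigma> N \<longleftrightarrow> \<Sigma> \<subseteq> identities S \<and> (\<forall>(s, t) \<in> \<Sigma>. length s \<le> N \<and> length t \<le> N)"

lemma ded_step_satisfies:
  assumes "basis S \<Sigma> N" "ded_step \<Sigma> u v"
  shows "satisfies S u v"
proof -
  obtain a b \<sigma> s t where st: "(s, t) \<in> \<Sigma> \<or> (t, s) \<in> \<Sigma>"
      "u = a @ subst \<sigma> s @ b" "v = a @ subst \<sigma> t @ b"
    using assms(2) unfolding ded_step_def by blast
  then have "satisfies S s t"
    using assms(1) by (auto simp: basis_def identities_def intro: satisfies_sym)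
  then show ?thesis
    using st(2,3) by (auto intro!: satisfies_append satisfies_subst satisfies_refl)
qed

lemma discrete_intermediate_value:
  fixes g :: "nat \<Rightarrow> nat"
  assumes "g 0 < l" "l < g n" "\<And>k. k \<le> n \<Longrightarrow> g k \<noteq> l"
  shows "\<exists>k<n. g k < l \<and> l < g (Suc k)"
  using assms
proof (induction n)
  case (Suc n)
  then show ?case
    by (metis le_Suc_eq less_Suc_eq linorder_neqE_nat order_refl)
qed simp

text \<open>A position between \<^term>\<open>c\<close> and \<^term>\<open>d\<close> that is not a boundary of the instance of the
  identity or of the image of one of its letters lies outside of the instance or strictly inside
  the image of a letter. That letter is linear, because its image contains the factor
  \<^term>\<open>[c, d]\<close>, which occurs only once, so the image can be changed.\<close>

lemma ded_step_insert_aux: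
  fixes S :: "'a::monoid_mult itself"
  assumes lin: "lin S" and sat: "satisfies S s t"
    and st: "(s, t) \<in> \<Sigma> \<or> (t, s) \<in> \<Sigma>"
    and w: "w = a @ subst \<sigma> s @ b" and w': "w' = a @ subst \<sigma> t @ b"
    and once: "once w c d" and p: "w = p @ c # d # q"
    and l: "\<And>k. k \<le> length s \<Longrightarrow> length (a @ subst \<sigma> (take k s)) \<noteq> Suc (length p)"
  shows "\<exists>p' q'. w' = p' @ q' \<and> ded_step \<Sigma> (p @ c # T # d # q) (p' @ T # q')"
proof -
  let ?l = "Suc (length p)"
  let ?g = "\<lambda>k. length (a @ subst \<sigma> (take k s))"
  \<comment> \<open>If the cut between \<open>c\<close> and \<open>d\<close> is strictly inside the
    block \<open>E\<close> of \<open>w\<close>, then both letters belong to this block.\<close>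
  have split: "\<exists>g h. p = X @ g \<and> E = g @ c # d # h \<and> q = h @ Y"
    if E: "w = X @ E @ Y" "length X < ?l" "?l < length (X @ E)" for X E Y
  proof -
    have "X @ (E @ Y) = p @ c # d # q" using E(1) p by simp
    then have "X = take (length X) p" "E @ Y = drop (length X) p @ c # d # q"
      using append_eq_append_conv_if[of X "E @ Y" p "c # d # q"] E(2) by simp_all
    then obtain r where r: "p = X @ r" "E @ Y = r @ c # d # q"
      by (metis append_take_drop_id)
    have "(r @ [c, d]) @ q = E @ Y" "length (r @ [c, d]) \<le> length E"
      using r E(3) by simp_all
    then obtain h where "E = (r @ [c, d]) @ h" "q = h @ Y"
      by (metis append_eq_append_conv_if append_take_drop_id)
    then have "E = r @ c # d # h" "q = h @ Y" by simp_all
    with r show ?thesis by blast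
  qed
  consider "?l < length a" | "length (a @ subst \<sigma> s) < ?l" | "length a < ?l" "?l < length (a @ subst \<sigma> s)"
    using l[of 0] l[of "length s"] by force
  then show ?thesis
  proof cases
    case 1
    then obtain h where h: "a = p @ c # d # h" "q = h @ subst \<sigma> s @ b"
      using split[of "[]" a "subst \<sigma> s @ b"] w by auto
    have "ded_step \<Sigma> (p @ c # T # d # q) (p @ c # T # d # h @ subst \<sigma> t @ b)"
      unfolding ded_step_def using st h(2)
      by (intro exI[of _ "p @ c # T # d # h"] exI[of _ b] exI[of _ \<sigma>] exI[of _ s] exI[of _ t]) simp
    then show ?thesis
      using w' h(1) by (intro exI[of _ "p @ [c]"] exI[of _ "d # h @ subst \<sigma> t @ b"]) simp
  next
    case 2
    have "?l < length w" using p by simp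
    then obtain g where g: "p = (a @ subst \<sigma> s) @ g" "b = g @ c # d # q"
      using split[of "a @ subst \<sigma> s" b "[]"] w 2 by auto
    have "ded_step \<Sigma> (p @ c # T # d # q) (a @ subst \<sigma> t @ g @ c # T # d # q)"
      unfolding ded_step_def using st g(1)
      by (intro exI[of _ a] exI[of _ "g @ c # T # d # q"] exI[of _ \<sigma>] exI[of _ s] exI[of _ t]) simp
    then show ?thesis
      using w' g(2) by (intro exI[of _ "a @ subst \<sigma> t @ g @ [c]"] exI[of _ "d # q"]) simp
  next
    case 3
    then obtain k where k: "k < length s" "?g k < ?l" "?l < ?g (Suc k)"
      using discrete_intermediate_value[of ?g ?l "length s"] l by auto
    define s1 e s2 where "s1 = take k s" and "e = s ! k" and "s2 = drop (Suc k) s"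
    have s: "s = s1 @ e # s2" and s1e: "take (Suc k) s = s1 @ [e]"
      using k(1) by (simp_all add: s1_def s2_def e_def id_take_nth_drop take_Suc_conv_app_nth)
    have "w = (a @ subst \<sigma> s1) @ \<sigma> e @ (subst \<sigma> s2 @ b)"
      by (simp only: w s subst_simps append_assoc)
    moreover have "length (a @ subst \<sigma> s1) < ?l"
      using k(2) by (simp only: s1_def)
    moreover have "?l < length ((a @ subst \<sigma> s1) @ \<sigma> e)"
      using k(3) unfolding s1e by simp
    ultimately obtain g h where gh: "p = (a @ subst \<sigma> s1) @ g" "\<sigma> e = g @ c # d # h" "q = h @ subst \<sigma> s2 @ b"
      using split by blast
    have e1: "e \<notin> set s1"
    proof
      assume "e \<in> set s1"
      then obtain r1 r2 where r: "s1 = r1 @ e # r2" by (meson split_list)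
      have "w = (a @ subst \<sigma> r1 @ g) @ c # d # (h @ subst \<sigma> r2 @ subst \<sigma> (e # s2) @ b)"
        using w s r gh(2) by simp
      with once p have "p = a @ subst \<sigma> r1 @ g" unfolding once_def by blast
      then show False using gh(1) r gh(2) by simp
    qed
    have e2: "e \<notin> set s2"
    proof
      assume "e \<in> set s2"
      then obtain r1 r2 where r: "s2 = r1 @ e # r2" by (meson split_list)
      have "w = (a @ subst \<sigma> s1 @ \<sigma> e @ subst \<sigma> r1 @ g) @ c # d # (h @ subst \<sigma> r2 @ b)"
        using w s r gh(2) by simp
      with once p have "p = a @ subst \<sigma> s1 @ \<sigma> e @ subst \<sigma> r1 @ g" unfolding once_def by blast
      then show False using gh(1,2) by simp
    qed
    \<comment> \<open>As \<open>e\<close> is linear in \<open>t\<close> as well, enlarging its image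
      by \<open>T\<close> inserts exactly one copy of \<open>T\<close> on the other side.\<close>
    obtain t1 t2 where t: "t = t1 @ e # t2" "e \<notin> set t1" "e \<notin> set t2"
      using satisfies_linear[OF lin sat s e1 e2] by blast
    let ?\<tau> = "\<sigma>(e := g @ c # T # d # h)"
    have "ded_step \<Sigma> (a @ subst ?\<tau> s @ b) (a @ subst ?\<tau> t @ b)"
      unfolding ded_step_def using st by blast
    moreover have "a @ subst ?\<tau> s @ b = p @ c # T # d # q"
      using s e1 e2 gh by simp
    moreover have "a @ subst ?\<tau> t @ b = (a @ subst \<sigma> t1 @ g @ [c]) @ T # (d # h @ subst \<sigma> t2 @ b)"
      using t by simp
    moreover have "w' = (a @ subst \<sigma> t1 @ g @ [c]) @ (d # h @ subst \<sigma> t2 @ b)"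
      using w' t gh(2) by simp
    ultimately show ?thesis by metis
  qed
qed

text \<open>Pigeonhole: the prefixes of \<open>s\<close> yield at most \<open>length s + 1\<close>
  boundaries in \<open>w\<close>, while distinct pairs in \<open>F\<close> have distinct cut points,
  since a position determines the two letters around it. Hence some cut point is not a
  boundary.\<close>

lemma ded_step_insert:
  fixes S :: "'a::monoid_mult itself"
  assumes bas: "basis S \<Sigma> N" and lin: "lin S" and step: "ded_step \<Sigma> w w'"
    and card: "Suc N < card F"
    and once: "\<And>c d. (c, d) \<in> F \<Longrightarrow> once w c d"
  obtains c d p q p' q' where "(c, d) \<in> F" "w = p @ c # d # q" "w' = p' @ q'"
    "ded_step \<Sigma> (p @ c # T # d # q) (p' @ T # q')"
proof -
  obtain a b \<sigma> s t where st: "(s, t) \<in> \<Sigma> \<or> (t, s) \<in> \<Sigma>"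
      and w: "w = a @ subst \<sigma> s @ b" and w': "w' = a @ subst \<sigma> t @ b"
    using step unfolding ded_step_def by blast
  have sat: "satisfies S s t" and len: "length s \<le> N"
    using bas st by (auto simp: basis_def identities_def intro: satisfies_sym)
  define B where "B = (\<lambda>k. length (a @ subst \<sigma> (take k s))) ` {..length s}"
  have "card B \<le> Suc N"
    unfolding B_def using card_image_le[of "{..length s}"] len by (metis card_atMost finite_atMost le_trans Suc_le_mono)
  have "\<forall>x\<in>F. \<exists>p. \<exists>q. w = p @ fst x # snd x # q"
    using once unfolding once_def by fastforce
  then obtain P where P: "\<And>x. x \<in> F \<Longrightarrow> \<exists>q. w = P x @ fst x # snd x # q"
    by metis
  have "inj_on (\<lambda>x. Suc (length (P x))) F"
  proof (rule inj_onI)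
    fix x y assume "x \<in> F" "y \<in> F" "Suc (length (P x)) = Suc (length (P y))"
    then show "x = y"
      using P[of x] P[of y] by (auto simp: prod_eq_iff)
  qed
  then have "card B < card ((\<lambda>x. Suc (length (P x))) ` F)"
    using card \<open>card B \<le> Suc N\<close> by (simp add: card_image)
  moreover have "finite B" by (simp add: B_def)
  ultimately have "\<not> (\<lambda>x. Suc (length (P x))) ` F \<subseteq> B"
    using card_mono leD by blast
  then obtain x where x: "x \<in> F" "Suc (length (P x)) \<notin> B" by blast
  obtain c d where cd: "x = (c, d)" by (cases x)
  obtain q where q: "w = P x @ c # d # q" using P[OF x(1)] cd by auto
  have "length (a @ subst \<sigma> (take k s)) \<noteq> Suc (length (P x))" if "k \<le> length s" for k
  proof
    assume "length (a @ subst \<sigma> (take k s)) = Suc (length (P x))"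
    then have "Suc (length (P x)) \<in> B"
      unfolding B_def using that by (intro image_eqI[of _ _ k]) simp_all
    then show False using x(2) by contradiction
  qed
  with x(1) cd once have "\<exists>p' q'. w' = p' @ q' \<and> ded_step \<Sigma> (P x @ c # T # d # q) (p' @ T # q')"
    by (intro ded_step_insert_aux[OF lin sat st w w' _ q]) simp_all
  then show ?thesis using that x(1) q cd by blast
qed

text \<open>The index \<open>n\<close> is chosen only after the basis, with \<open>k\<close> as the
  allowance a case needs beyond \<open>N\<close>. A step may use that its word equals
  \<open>U n\<close> in \<open>S\<close>, as this holds along the whole derivation.\<close>

lemma not_finitely_based_if_invariant:
  fixes S :: "'a::monoid_mult itself"
  assumes sat: "\<And>n. 1 < n \<Longrightarrow> satisfies S (U n) (V n)"
    and ne: "\<And>n. 1 < n \<Longrightarrow> U n \<noteq> [] \<and> V n \<noteq> []"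
    and U: "\<And>n. 1 < n \<Longrightarrow> I n (U n)" and V: "\<And>n. 1 < n \<Longrightarrow> \<not> I n (V n)"
    and step: "\<And>\<Sigma> N n w w'. \<lbrakk>basis S \<Sigma> N; N + k < n; 1 < n; satisfies S (U n) w; I n w; ded_step \<Sigma> w w'\<rbrakk> \<Longrightarrow> I n w'"
  shows "\<not> finitely_based S"
proof
  assume "finitely_based S"
  then obtain \<Sigma> where \<Sigma>: "finite \<Sigma>" "\<Sigma> \<subseteq> identities S"
      "\<And>u v. (u, v) \<in> identities S \<Longrightarrow> derivable \<Sigma> u v"
    unfolding finitely_based_def by blast
  \<comment> \<open>The sum of both lengths bounds each side, as identities are used in both
    directions; the 0 covers an empty basis.\<close>
  define N where "N = Max (insert 0 ((\<lambda>(s, t). length s + length t) ` \<Sigma>))"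
  have "length s + length t \<le> N" if "(s, t) \<in> \<Sigma>" for s t
    unfolding N_def using \<Sigma>(1) that by (intro Max_ge) force+
  then have bas: "basis S \<Sigma> N"
    using \<Sigma>(2) unfolding basis_def by fastforce
  define n where "n = N + k + 2"
  have n: "1 < n" "N + k < n" by (simp_all add: n_def)
  have "(ded_step \<Sigma>)\<^sup>*\<^sup>* (U n) (V n)"
    using \<Sigma>(3)[of "U n" "V n"] sat[OF n(1)] ne[OF n(1)] by (simp add: identities_def derivable_def)
  then have "satisfies S (U n) (V n) \<and> I n (V n)"
  proof (induction rule: rtranclp_induct)
    case base
    then show ?case using U[OF n(1)] by (simp add: satisfies_refl)
  next
    case (step v w)
    then show ?case
      using assms(5)[OF bas n(2,1)] satisfies_trans ded_step_satisfies[OF bas] by blast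
  qed
  with V[OF n(1)] show False by simp
qed

section \<open>Short isoterms\<close>

lemma in_shuffles_proj:
  assumes "set w \<subseteq> X \<union> Y" "X \<inter> Y = {}"
  shows "w \<in> shuffles (proj X w) (proj Y w)"
proof -
  have "filter (\<lambda>v. v \<notin> X) w = proj Y w"
    using assms by (intro filter_cong) auto
  then show ?thesis using partition_in_shuffles[of w "\<lambda>v. v \<in> X"] by simp
qed

lemma isoterm_append_left: "isoterm S (a @ u) \<Longrightarrow> isoterm S u"
  using isoterm_factor[of S a u "[]"] by simp

lemma isoterm_append_right: "isoterm S (u @ b) \<Longrightarrow> isoterm S u"
  using isoterm_factor[of S "[]" u b] by simp

lemma isoterm_xyyxD:
  assumes "isoterm S [x, y, y, x]"
  shows "isoterm S [x, y, y]" "isoterm S [y, y, x]" "isoterm S [y, y]"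
  using isoterm_factor[of S "[]" "[x, y, y]" "[x]"] isoterm_factor[of S "[x]" "[y, y, x]" "[]"]
    isoterm_factor[of S "[x]" "[y, y]" "[x]"] assms by simp_all

definition iso_xtx :: "'a::monoid_mult itself \<Rightarrow> bool" where
  "iso_xtx S \<longleftrightarrow> (\<forall>x t. x \<noteq> t \<longrightarrow> isoterm S [x, t, x])"

text \<open>Replace the linear middle letter by \<open>m\<close>. A word equal to
  \<open>[x, a, x]\<close> has the form of a power of \<open>x\<close>, then \<open>a\<close>, then
  a power of \<open>x\<close>. After the replacement the first power is the maximal initial run of
  \<open>x\<close>, since \<open>m\<close> begins with another letter, and the isoterm fixes
  it.\<close>

lemma iso_xtxI:
  assumes iso: "isoterm S (x # m @ [x])" and m: "m \<noteq> []" "x \<notin> set m"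
  shows "iso_xtx S"
  unfolding iso_xtx_def
proof (intro allI impI)
  fix y t :: nat assume "y \<noteq> t"
  \<comment> \<open>Any letter other than \<open>x\<close> would do; a renaming leads to the
    required \<open>y\<close> and \<open>t\<close> at the end.\<close>
  define a where "a = Suc x"
  then have a: "a \<noteq> x" by simp
  have lin: "lin S" using iso by (rule isoterm_lin) simp
  have "isoterm S [x, a, x]"
  proof (rule isotermI)
    fix v assume sat: "satisfies S [x, a, x] v"
    obtain v1 v2 where v: "v = v1 @ a # v2" "a \<notin> set v1" "a \<notin> set v2"
      using satisfies_linear[OF lin sat, of "[x]" a "[x]"] a by auto
    have sub: "\<forall>b\<in>set v1. b = x" "\<forall>b\<in>set v2. b = x"
      using satisfies_set[OF lin sat] v by auto
    let ?\<sigma> = "(\<lambda>b. [b])(a := m)"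
    have id: "subst ?\<sigma> u = u" if "a \<notin> set u" for u
      using that by (induction u) auto
    have "satisfies S (x # m @ [x]) (v1 @ m @ v2)"
      using satisfies_subst[OF sat, of ?\<sigma>] v id a by simp
    then have eq: "v1 @ m @ v2 = [x] @ m @ [x]"
      using isotermD[OF iso] by simp
    obtain b m' where m': "m = b # m'" "b \<noteq> x" using m by (cases m) auto
    have "takeWhile (\<lambda>c. c = x) (v1 @ m @ v2) = v1"
      using sub(1) m' by (subst takeWhile_append2) auto
    then have "v1 = [x]" using eq m' by simp
    then show "v = [x, a, x]" using eq v(1) by simp
  qed
  then have "isoterm S (map ((\<lambda>_. y)(a := t)) [x, a, x])"
    by (rule isoterm_map) (use a \<open>y \<noteq> t\<close> in auto)
  then show "isoterm S [y, t, y]" using a by simp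
qed

text \<open>Letters are natural numbers, and every hypothesis \<^prop>\<open>x \<noteq> y\<close> on letters would make the
  arithmetic procedure of the simplifier split cases.\<close>

context
  notes [[linarith_neq_limit = 0]]
  fixes S :: "'a::monoid_mult itself"
  assumes xtx: "iso_xtx S"
begin

lemma isoterm_xtx: "x \<noteq> t \<Longrightarrow> isoterm S [x, t, x]"
  using xtx by (simp add: iso_xtx_def)

lemma isoterm_ts: "t \<noteq> s \<Longrightarrow> isoterm S [t, s]"
  using isoterm_append_right[of S "[t, s]" "[t]"] isoterm_xtx by simp

lemma lin_if_xtx: "lin S"
  using isoterm_lin[OF isoterm_ts[of 0 1]] by simp

lemma isoterm_xtsx:
  assumes "distinct [x, t, s]"
  shows "isoterm S [x, t, s, x]"
proof -
  have [simp]: "x \<noteq> t" "t \<noteq> x" "x \<noteq> s" "s \<noteq> x" "t \<noteq> s" "s \<noteq> t"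
    using assms by auto
  show ?thesis
  proof (rule isoterm_if_adjacent[OF _ lin_if_xtx])
  let ?R = "\<lambda>c d. \<exists>X. c \<in> X \<and> d \<in> X \<and> isoterm S (proj X [x, t, s, x])"
  have "?R x t" by (rule exI[of _ "{x, t}"]) (use assms in \<open>simp add: isoterm_xtx\<close>)
  moreover have "?R t s" by (rule exI[of _ "{t, s}"]) (use assms in \<open>simp add: isoterm_ts\<close>)
  moreover have "?R s x" by (rule exI[of _ "{x, s}"]) (use assms in \<open>simp add: isoterm_xtx\<close>)
  ultimately show "successively ?R [x, t, s, x]" by simp
qed simp
qed

text \<open>Adjacent pairs do not suffice, since \<open>[t, x, x]\<close> need not be an isoterm.
  The known projections leave only one competitor, \<open>[x, t, s, x]\<close>, which is an isoterm
  itself and so equals no other word.\<close>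

lemma isoterm_txsx:
  assumes "distinct [x, t, s]"
  shows "isoterm S [t, x, s, x]"
proof (rule isotermI)
  fix v assume sat: "satisfies S [t, x, s, x] v"
  have [simp]: "x \<noteq> t" "t \<noteq> x" "x \<noteq> s" "s \<noteq> x" "t \<noteq> s" "s \<noteq> t"
    using assms by auto
  have set: "set v = {t, x, s}" using satisfies_set[OF lin_if_xtx sat] by auto
  have p1: "proj {x, s} v = [x, s, x]"
    using isoterm_proj[OF sat, of "{x, s}"] assms by (simp add: isoterm_xtx)
  have p2: "proj {t, s} v = [t, s]"
    using isoterm_proj[OF sat, of "{t, s}"] assms by (simp add: isoterm_ts)
  have p3: "proj {t} v = [t]"
    using isoterm_proj[OF sat, of "{t}"] assms lin_if_xtx by (simp add: lin_def)
  have "v \<in> shuffles (proj {t} v) (proj {x, s} v)"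
    using set assms(1) by (intro in_shuffles_proj) auto
  then have "v \<in> shuffles [t] [x, s, x]"
    unfolding p1 p3 .
  then have "v = [t, x, s, x] \<or> v = [x, t, s, x]"
    using p2 assms by auto
  then show "v = [t, x, s, x]"
    using isotermD[OF isoterm_xtsx[OF assms]] satisfies_sym[OF sat] by auto
qed

text \<open>The mirror image of the previous argument, with the same competitor
  \<open>[x, t, s, x]\<close>.\<close>

lemma isoterm_xtxs:
  assumes "distinct [x, t, s]"
  shows "isoterm S [x, t, x, s]"
proof (rule isotermI)
  fix v assume sat: "satisfies S [x, t, x, s] v"
  have [simp]: "x \<noteq> t" "t \<noteq> x" "x \<noteq> s" "s \<noteq> x" "t \<noteq> s" "s \<noteq> t"
    using assms by auto
  have set: "set v = {t, x, s}" using satisfies_set[OF lin_if_xtx sat] by auto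
  have p1: "proj {x, t} v = [x, t, x]"
    using isoterm_proj[OF sat, of "{x, t}"] assms by (simp add: isoterm_xtx)
  have p2: "proj {t, s} v = [t, s]"
    using isoterm_proj[OF sat, of "{t, s}"] assms by (simp add: isoterm_ts)
  have p3: "proj {s} v = [s]"
    using isoterm_proj[OF sat, of "{s}"] assms lin_if_xtx by (simp add: lin_def)
  have "v \<in> shuffles (proj {s} v) (proj {x, t} v)"
    using set assms(1) by (intro in_shuffles_proj) auto
  then have "v \<in> shuffles [s] [x, t, x]"
    unfolding p1 p3 .
  then have "v = [x, t, x, s] \<or> v = [x, t, s, x]"
    using p2 assms by auto
  then show "v = [x, t, x, s]"
    using isotermD[OF isoterm_xtsx[of x t s]] satisfies_sym[OF sat] by auto
qed

text \<open>The projections avoiding \<open>y\<close> or \<open>x\<close> leave open only the order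
  of the neighbouring \<open>y\<close> and \<open>x\<close> in the middle. The other order is the
  given isoterm, which cannot equal a different word.\<close>

lemma isoterm_xtyxsy:
  assumes "distinct [x, t, y, s]" and "isoterm S [x, t, x, y, s, y]"
  shows "isoterm S [x, t, y, x, s, y]"
proof (rule isotermI)
  fix v assume sat: "satisfies S [x, t, y, x, s, y] v"
  have [simp]: "x \<noteq> t" "t \<noteq> x" "x \<noteq> s" "s \<noteq> x" "t \<noteq> s" "s \<noteq> t"
    "y \<noteq> t" "t \<noteq> y" "y \<noteq> s" "s \<noteq> y" "y \<noteq> x" "x \<noteq> y"
    using assms(1) by auto
  have set: "set v = {t, x, s, y}" using satisfies_set[OF lin_if_xtx sat] by auto
  have p1: "proj {x, t, s} v = [x, t, x, s]"
    using isoterm_proj[OF sat, of "{x, t, s}"] assms by (simp add: isoterm_xtxs)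
  have p2: "proj {y, t, s} v = [t, y, s, y]"
    using isoterm_proj[OF sat, of "{y, t, s}"] assms by (simp add: isoterm_txsx)
  have "proj {x} (proj {x, t, s} v) = [x, x]"
    using assms(1) unfolding p1 by simp
  then have p3: "proj {x} v = [x, x]"
    by (simp add: conj_commute cong: conj_cong)
  have *: "\<forall>v \<in> shuffles [x, x] [t, y, s, y]. proj {x, t, s} v = [x, t, x, s] \<longrightarrow>
      v = [x, t, y, x, s, y] \<or> v = [x, t, x, y, s, y]"
    using assms(1) by simp
  have "v \<in> shuffles (proj {x} v) (proj {y, t, s} v)"
    using set assms(1) by (intro in_shuffles_proj) auto
  then have "v \<in> shuffles [x, x] [t, y, s, y]"
    unfolding p2 p3 .
  then have "v = [x, t, y, x, s, y] \<or> v = [x, t, x, y, s, y]"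
    using * p1 by blast
  then show "v = [x, t, y, x, s, y]"
    using isotermD[OF assms(2)] satisfies_sym[OF sat] by auto
qed

end

section \<open>Words that become isoterms after inserting linear letters\<close>

text \<open>The uniqueness half of \<open>once\<close>, stated for a projection; there the condition
  becomes a check on a word of a few letters.\<close>

definition uniq :: "word \<Rightarrow> nat \<Rightarrow> nat \<Rightarrow> bool" where
  "uniq u c d \<longleftrightarrow> (\<forall>p q p' q'. u = p @ c # d # q \<longrightarrow> u = p' @ c # d # q' \<longrightarrow> length p = length p')"

lemma onceI:
  assumes "w = p @ c # d # q" "uniq (proj {c, d} w) c d"
  shows "once w c d"
proof (rule onceI_proj[of _ _ _ "{c, d}"])
  show "(c, d) \<in> adjs w" using assms(1) by (rule adjsI)
  fix p q p' q'
  assume "proj {c, d} w = p @ c # d # q" "proj {c, d} w = p' @ c # d # q'"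
  then show "length p = length p'"
    using assms(2) unfolding uniq_def by blast
qed simp_all

text \<open>Injectivity of \<open>c\<close> provides \<open>n - 1\<close> different factors, and
  \<open>N + 2 < n\<close> makes this number exceed \<open>N + 1\<close>.\<close>

lemma ded_step_insert_family:
  fixes S :: "'a::monoid_mult itself"
  assumes bas: "basis S \<Sigma> N" and lin: "lin S" and step: "ded_step \<Sigma> w w'"
    and card: "N + 2 < n" and inj: "inj c"
    and fam: "\<And>i. 1 \<le> i \<Longrightarrow> i < n \<Longrightarrow> w = P i @ c i # d i # Q i \<and> uniq (proj {c i, d i} w) (c i) (d i)"
  obtains i p' q' where "1 \<le> i" "i < n" "w' = p' @ q'"
    "ded_step \<Sigma> (P i @ c i # T # d i # Q i) (p' @ T # q')"
proof -
  let ?F = "(\<lambda>i. (c i, d i)) ` {1..<n}"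
  have "card ?F = n - 1"
    by (subst card_image) (use inj in \<open>auto simp: inj_on_def\<close>)
  then have card': "Suc N < card ?F" using card by simp
  have once: "once w a b" if "(a, b) \<in> ?F" for a b
    using that fam by (auto intro!: onceI)
  obtain a b p q p' q' where *: "(a, b) \<in> ?F" "w = p @ a # b # q" "w' = p' @ q'"
      "ded_step \<Sigma> (p @ a # T # b # q) (p' @ T # q')"
    using ded_step_insert[OF bas lin step card' once] .
  then obtain i where i: "1 \<le> i" "i < n" "a = c i" "b = d i" by auto
  have "p = P i" using once[OF *(1)] *(2) fam[OF i(1,2)] i(3,4) unfolding once_def by blast
  moreover have "q = Q i" using calculation *(2) fam[OF i(1,2)] i(3,4) by simp
  ultimately show ?thesis using that i * by simp
qed

text \<open>The modified step starts from an isoterm, so it ends at the very same word. Deleting the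
  new letter \<open>T\<close> shows that the original step did not change
  \<open>U n\<close>.\<close>

lemma not_finitely_based_if_isoterm1:
  fixes S :: "'a::monoid_mult itself" and U V :: "nat \<Rightarrow> word"
  assumes sat: "\<And>n. 1 < n \<Longrightarrow> satisfies S (U n) (V n)"
    and ne: "\<And>n. 1 < n \<Longrightarrow> V n \<noteq> [] \<and> V n \<noteq> U n"
    and lin: "lin S" and inj: "inj c"
    and fam: "\<And>n i. 1 \<le> i \<Longrightarrow> i < n \<Longrightarrow> U n = P n i @ c i # d i # Q n i \<and> uniq (proj {c i, d i} (U n)) (c i) (d i)"
    and T: "\<And>n. T \<notin> set (U n)"
    and iso: "\<And>n i. 1 \<le> i \<Longrightarrow> i < n \<Longrightarrow> isoterm S (P n i @ c i # T # d i # Q n i)"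
  shows "\<not> finitely_based S"
proof (rule not_finitely_based_if_invariant[of S U V "\<lambda>n w. w = U n" 2])
  show "U n \<noteq> [] \<and> V n \<noteq> []" if "1 < n" for n
    using fam[of 1 n] ne that by auto
next
  fix \<Sigma> N n w w'
  assume bas: "basis S \<Sigma> N" and n: "N + 2 < n" and w: "w = U n" and step: "ded_step \<Sigma> w w'"
  obtain i p' q' where i: "1 \<le> i" "i < n" "w' = p' @ q'"
      "ded_step \<Sigma> (P n i @ c i # T # d i # Q n i) (p' @ T # q')"
    using ded_step_insert_family[OF bas lin step n inj, of "P n" d "Q n"] fam w by metis
  have "p' @ T # q' = P n i @ c i # T # d i # Q n i"
    using isotermD[OF iso[OF i(1,2)]] ded_step_satisfies[OF bas i(4)] by blast
  then have "filter (\<lambda>v. v \<noteq> T) (p' @ T # q') = filter (\<lambda>v. v \<noteq> T) (P n i @ c i # T # d i # Q n i)"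
    by simp
  then have "filter (\<lambda>v. v \<noteq> T) w' = filter (\<lambda>v. v \<noteq> T) (U n)"
    using i(3) fam[OF i(1,2)] by auto
  moreover have "set w' = set (U n)"
    using satisfies_set[OF lin] ded_step_satisfies[OF bas step] w by blast
  ultimately show "w' = U n"
    using T[of n] by (metis (mono_tags, lifting) filter_True)
qed (use sat ne in auto)

text \<open>Two insertions in succession: the step carrying \<open>T\<close> is again a deduction
  step, and the factors of the second family still occur once in its starting word because
  \<open>T\<close> is none of their letters.\<close>

lemma not_finitely_based_if_isoterm2:
  fixes S :: "'a::monoid_mult itself" and U V :: "nat \<Rightarrow> word"
  assumes sat: "\<And>n. 1 < n \<Longrightarrow> satisfies S (U n) (V n)"
    and ne: "\<And>n. 1 < n \<Longrightarrow> V n \<noteq> [] \<and> V n \<noteq> U n"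
    and lin: "lin S" and inj: "inj c" "inj c'"
    and fam: "\<And>n i k. 1 \<le> i \<Longrightarrow> i < n \<Longrightarrow> 1 \<le> k \<Longrightarrow> k < n \<Longrightarrow>
      U n = P n i @ c i # d i # M n i k @ c' k # d' k # Q n k
      \<and> uniq (proj {c i, d i} (U n)) (c i) (d i) \<and> uniq (proj {c' k, d' k} (U n)) (c' k) (d' k)"
    and T: "\<And>n. T \<notin> set (U n)" "\<And>n. T' \<notin> set (U n)"
    and iso: "\<And>n i k. 1 \<le> i \<Longrightarrow> i < n \<Longrightarrow> 1 \<le> k \<Longrightarrow> k < n \<Longrightarrow>
      isoterm S (P n i @ c i # T # d i # M n i k @ c' k # T' # d' k # Q n k)"
  shows "\<not> finitely_based S"
proof (rule not_finitely_based_if_invariant[of S U V "\<lambda>n w. w = U n" 2])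
  show "U n \<noteq> [] \<and> V n \<noteq> []" if "1 < n" for n
    using fam[of 1 n 1] ne that by auto
next
  fix \<Sigma> N n w w'
  assume bas: "basis S \<Sigma> N" and n: "N + 2 < n" and w: "w = U n" and step: "ded_step \<Sigma> w w'"
  \<comment> \<open>The index 1 only serves to write down the part of \<open>U n\<close> after the
    first cut, which is the same word for every \<open>k\<close>.\<close>
  have n1: "1 \<le> (1::nat)" "1 < n" using n by simp_all
  obtain i p' q' where i: "1 \<le> i" "i < n" "w' = p' @ q'"
      "ded_step \<Sigma> (P n i @ c i # T # d i # (M n i 1 @ c' 1 # d' 1 # Q n 1)) (p' @ T # q')"
    using ded_step_insert_family[OF bas lin step n inj(1), of "P n" d "\<lambda>i. M n i 1 @ c' 1 # d' 1 # Q n 1"]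
      fam[OF _ _ n1] w by metis
  define w1 where "w1 = P n i @ c i # T # d i # (M n i 1 @ c' 1 # d' 1 # Q n 1)"
  have fam': "w1 = (P n i @ c i # T # d i # M n i k) @ c' k # d' k # Q n k
      \<and> uniq (proj {c' k, d' k} w1) (c' k) (d' k)" if k: "1 \<le> k" "k < n" for k
  proof
    have "M n i 1 @ c' 1 # d' 1 # Q n 1 = M n i k @ c' k # d' k # Q n k"
      using fam[OF i(1,2) n1] fam[OF i(1,2) k] by simp
    then show "w1 = (P n i @ c i # T # d i # M n i k) @ c' k # d' k # Q n k"
      by (simp add: w1_def)
    have U: "U n = P n i @ c i # d i # (M n i 1 @ c' 1 # d' 1 # Q n 1)"
      using fam[OF i(1,2) n1] by simp
    have "T \<notin> {c' k, d' k}" using fam[OF i(1,2) k] T(1)[of n] by auto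
    then have eq: "proj {c' k, d' k} w1 = proj {c' k, d' k} (U n)"
      unfolding w1_def U by simp
    show "uniq (proj {c' k, d' k} w1) (c' k) (d' k)"
      unfolding eq using fam[OF i(1,2) k] by blast
  qed
  \<comment> \<open>The insertion of \<open>T'\<close> is applied to the step that already contains
    \<open>T\<close>.\<close>
  obtain k p2 q2 where k: "1 \<le> k" "k < n" "p' @ T # q' = p2 @ q2"
      "ded_step \<Sigma> ((P n i @ c i # T # d i # M n i k) @ c' k # T' # d' k # Q n k) (p2 @ T' # q2)"
    using ded_step_insert_family[OF bas lin i(4) n inj(2),
        of "\<lambda>k. P n i @ c i # T # d i # M n i k" d' "Q n"] fam' unfolding w1_def by metis
  let ?f = "filter (\<lambda>v. v \<noteq> T \<and> v \<noteq> T')"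
  have "p2 @ T' # q2 = (P n i @ c i # T # d i # M n i k) @ c' k # T' # d' k # Q n k"
    using isotermD[OF iso[OF i(1,2) k(1,2)]] ded_step_satisfies[OF bas k(4)] by simp
  then have "?f (p2 @ T' # q2) = ?f (P n i @ c i # T # d i # M n i k @ c' k # T' # d' k # Q n k)"
    by simp
  moreover have "?f (p2 @ T' # q2) = ?f w'"
    using arg_cong[OF k(3), of ?f] i(3) by simp
  moreover have "?f (P n i @ c i # T # d i # M n i k @ c' k # T' # d' k # Q n k) = ?f (U n)"
    using fam[OF i(1,2) k(1,2)] by simp
  ultimately have "?f w' = ?f (U n)" by simp
  moreover have "set w' = set (U n)"
    using satisfies_set[OF lin] ded_step_satisfies[OF bas step] w by blast
  then have "?f w' = w'" "?f (U n) = U n"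
    using T[of n] by (auto simp: filter_id_conv)
  ultimately show "w' = U n" by (rule box_equals)
qed (use sat ne in auto)

section \<open>Projections of the words in the theorem\<close>

lemma filter_upt_eq: "filter (\<lambda>j. j = i) [a..<b] = (if a \<le> i \<and> i < b then [i] else [])"
  by (induction b) auto

lemma filter_upt_eq2:
  "i < k \<Longrightarrow> filter (\<lambda>j. j = i \<or> j = k) [a..<b] =
    (if a \<le> i \<and> i < b then [i] else []) @ (if a \<le> k \<and> k < b then [k] else [])"
  by (induction b) auto

lemma filter_rev: "filter Q (rev w) = rev (filter Q w)"
  by (simp add: rev_filter)

lemma successively_map_upt:
  "(\<And>j. a \<le> j \<Longrightarrow> Suc j < b \<Longrightarrow> R (f j) (f (Suc j))) \<Longrightarrow> successively R (map f [a..<b])"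
  by (auto simp: successively_conv_nth)

lemma upt_split: "a \<le> b \<Longrightarrow> b \<le> c \<Longrightarrow> [a..<c] = [a..<b] @ [b..<c]"
  by (metis le_add_diff_inverse upt_add_eq_append)

lemma up_split: "i \<le> n \<Longrightarrow> up f n = map f [Suc 0..<Suc i] @ map f [Suc i..<Suc n]"
  using upt_split[of "Suc 0" "Suc i" "Suc n"] by (simp add: up_def del: upt_Suc)

lemma map_upt_snoc: "Suc 0 \<le> i \<Longrightarrow> map f [Suc 0..<Suc i] = map f [Suc 0..<i] @ [f i]"
  by simp

lemma map_upt_Cons: "i < n \<Longrightarrow> map f [Suc i..<Suc n] = f (Suc i) # map f [Suc (Suc i)..<Suc n]"
  by (simp add: upt_conv_Cons del: upt_Suc)

lemmas proj_simps = filter_map filter_rev comp_def filter_upt_eq filter_upt_eq2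

lemma uniq_abba: "a \<noteq> b \<Longrightarrow> uniq [a, b, b, a] a b"
  by (auto simp: uniq_def Cons_eq_append_conv)

text \<open>Turns a word of \<open>W\<close> over its fixed letters \<open>ls\<close> into the same
  pattern over arbitrary distinct letters \<open>ls'\<close>.\<close>

lemma isoterm_rename:
  assumes "isoterm S w" "set w \<subseteq> set ls" "distinct ls" "distinct ls'" "length ls' = length ls"
  shows "isoterm S (map (the \<circ> map_of (zip ls ls')) w)"
proof (rule isoterm_map[OF assms(1)], rule inj_on_subset[OF _ assms(2)], rule inj_onI)
  fix x y assume xy: "x \<in> set ls" "y \<in> set ls" "(the \<circ> map_of (zip ls ls')) x = (the \<circ> map_of (zip ls ls')) y"
  obtain i j where ij: "i < length ls" "x = ls ! i" "j < length ls" "y = ls ! j"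
    using xy by (metis in_set_conv_nth)
  have "map_of (zip ls ls') (ls ! i) = Some (ls' ! i)" if "i < length ls" for i
    using that assms by (simp add: map_of_zip_nth)
  then have "ls' ! i = ls' ! j" using xy(3) ij by simp
  then show "x = y" using ij assms by (simp add: nth_eq_iff_index_eq)
qed

abbreviation "vT \<equiv> var 10 0"
abbreviation "vT' \<equiv> var 10 1"

section \<open>Cases 5 and 6\<close>

context
  fixes S :: "'a::monoid_mult itself"
  assumes W: "\<forall>w\<in>W56. isoterm S w"
begin

lemma W56_xtyxsy: "distinct [x, t, y, s] \<Longrightarrow> isoterm S [x, t, y, x, s, y]"
  using W isoterm_rename[of S "[vx, vt1, vy, vx, vt2, vy]" "[vx, vt1, vy, vt2]" "[x, t, y, s]"]
  by (simp add: W56_def)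

lemma W56_xytxy: "distinct [x, y, t] \<Longrightarrow> isoterm S [x, y, t, x, y]"
  using W isoterm_rename[of S "[vx, vy, vt, vx, vy]" "[vx, vy, vt]" "[x, y, t]"]
  by (simp add: W56_def)

lemma W56_xytyx: "distinct [x, y, t] \<Longrightarrow> isoterm S [x, y, t, y, x]"
  using W isoterm_rename[of S "[vx, vy, vt, vy, vx]" "[vx, vy, vt]" "[x, y, t]"]
  by (simp add: W56_def)

lemma W56_xtx: "iso_xtx S"
proof (rule iso_xtxI)
  show "isoterm S (vx # [vt1, vy] @ [vx])"
    using isoterm_append_right[of S "[vx, vt1, vy, vx]" "[vt2, vy]"] W by (simp add: W56_def)
qed simp_all

text \<open>Consecutive letters \<open>zs j\<close> are controlled by \<open>vt\<close>, which lies
  between their two occurrences. The letters \<open>vx\<close> and \<open>vy\<close> have no such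
  separator: their projection is \<open>xyyx\<close> or \<open>xyxy\<close>. Since
  \<open>1 <= i < n\<close>, the new letter lies after \<open>vx\<close>, \<open>vy\<close>,
  \<open>zs 1\<close> and before \<open>zs n\<close>, \<open>a\<close>, \<open>b\<close>, and the
  critical projections become patterns of \<open>W56\<close>.\<close>

lemma W56_isoterm:
  assumes i: "1 \<le> i" "i < n" and ab: "(a, b) = (vx, vy) \<or> (a, b) = (vy, vx)"
  shows "isoterm S ([vx, vy] @ map zs [1..<Suc i] @ vT # map zs [Suc i..<Suc n] @ [a, b, vt] @ down zs n)"
    (is "isoterm S ?w")
proof (rule isoterm_if_adjacent)
  note xtx = W56_xtx
  define R where "R = (\<lambda>c d. \<exists>X. c \<in> X \<and> d \<in> X \<and> isoterm S (proj X ?w))"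
  have RI: "R c d" if "isoterm S (proj X ?w)" "c \<in> X" "d \<in> X" for c d X
    using that unfolding R_def by blast
  note ps = proj_simps down_def up_def
  have n: "1 \<le> n" "Suc i \<le> n" using i by auto
  have U: "proj X ?w = proj X ([vx, vy] @ up zs n @ [a, b, vt] @ down zs n)" if "vT \<notin> X" for X
    using that n by (simp add: up_split[of i n zs] del: upt_Suc)
  have "isoterm S (proj {vx, vy, vT} ?w)"
    using i ab by (elim disjE) (simp_all add: ps W56_xytxy W56_xytyx)
  then have xy: "R vx vy" "R a b"
    using RI ab by blast+
  have zz: "R (zs j) (zs (Suc j)) \<and> R (zs (Suc j)) (zs j)" if "1 \<le> j" "Suc j < Suc n" for j
  proof -
    have "isoterm S (proj {zs j, zs (Suc j), vt} ?w)"
      using that ab by (subst U) (elim disjE; simp add: ps W56_xytyx)+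
    then show ?thesis using RI by blast
  qed
  have "isoterm S (proj {vy, zs 1, vT} ?w)"
    using i ab by (elim disjE) (simp_all add: ps W56_xytxy)
  then have first: "R vy (zs 1)"
    using RI by blast+
  \<comment> \<open>Here \<open>vT\<close> separates the two \<open>a\<close> and \<open>vt\<close>
    separates the two \<open>zs n\<close>, giving the interleaved pattern
    \<open>x t y x s y\<close>.\<close>
  have "isoterm S (proj {a, zs n, vT, vt} ?w)"
    using i ab by (elim disjE) (simp_all add: ps W56_xtyxsy)
  then have last: "R (zs n) a"
    using RI by blast+
  have "isoterm S (proj {zs i, vT, vt} ?w)"
    using i ab by (elim disjE) (simp_all add: ps isoterm_xtsx[OF xtx])
  then have T: "R (zs i) vT"
    using RI by blast+
  have "isoterm S (proj {zs (Suc i), vT, vt} ?w)"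
    using i ab by (elim disjE) (simp_all add: ps isoterm_txsx[OF xtx])
  then have T': "R vT (zs (Suc i))"
    using RI by blast+
  have "isoterm S (proj {b, vT, vt} ?w)"
    using i ab by (elim disjE) (simp_all add: ps isoterm_xtxs[OF xtx])
  then have t: "R b vt"
    using RI by blast+
  have "isoterm S (proj {zs n, vt} ?w)"
    using i ab by (elim disjE) (simp_all add: ps isoterm_xtx[OF xtx])
  then have t': "R vt (zs n)"
    using RI by blast+
  have up: "successively R (map zs [k..<l])" if "1 \<le> k" "l \<le> Suc n" for k l
    by (rule successively_map_upt) (use zz that in auto)
  have down: "successively R (down zs n)"
    unfolding down_def up_def successively_rev
    by (rule successively_map_upt) (use zz in auto)
  have hd_last: "hd (down zs n) = zs n"
    using n by (simp add: down_def up_def hd_rev last_map)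
  show "successively (\<lambda>c d. \<exists>X. c \<in> X \<and> d \<in> X \<and> isoterm S (proj X ?w)) ?w"
    unfolding R_def[symmetric]
    using i n xy first last T T' t t' up[of 1 "Suc i"] up[of "Suc i" "Suc n"] down
    by (simp add: successively_append_iff successively_Cons hd_map last_map hd_last del: upt_Suc)
qed (simp_all add: lin_if_xtx[OF W56_xtx])

text \<open>The two cases differ in the order \<open>a\<close>, \<open>b\<close> of the second pair
  \<open>vx\<close>, \<open>vy\<close>; the first letter already distinguishes \<open>V n\<close>
  from \<open>U n\<close>.\<close>

lemma W56_not_finitely_based:
  assumes ab: "(a, b) = (vx, vy) \<or> (a, b) = (vy, vx)"
    and U: "\<And>n. U n = [vx, vy] @ up zs n @ [a, b, vt] @ down zs n"
    and V: "\<And>n. V n \<noteq> [] \<and> hd (V n) = vy"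
    and sat: "\<And>n. 1 < n \<Longrightarrow> satisfies S (U n) (V n)"
  shows "\<not> finitely_based S"
proof (rule not_finitely_based_if_isoterm1[where U = U and V = V and c = zs and T = vT
      and d = "\<lambda>i. zs (Suc i)" and P = "\<lambda>n i. [vx, vy] @ map zs [1..<i]"
      and Q = "\<lambda>n i. map zs [Suc (Suc i)..<Suc n] @ [a, b, vt] @ down zs n"])
  show "V n \<noteq> [] \<and> V n \<noteq> U n" for n
    using V[of n] by (auto simp: U)
  show "vT \<notin> set (U n)" for n
    using ab by (auto simp: U up_def down_def)
next
  fix n i :: nat assume i: "1 \<le> i" "i < n"
  have split: "up zs n = map zs [1..<i] @ zs i # zs (Suc i) # map zs [Suc (Suc i)..<Suc n]"
    using i upt_split[of 1 i "Suc n"] by (simp add: up_def upt_conv_Cons del: upt_Suc)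
  have "proj {zs i, zs (Suc i)} (U n) = [zs i, zs (Suc i), zs (Suc i), zs i]"
    using i ab by (elim disjE) (simp_all add: U proj_simps up_def down_def del: upt_Suc)
  then show "U n = ([vx, vy] @ map zs [1..<i]) @ zs i # zs (Suc i) # map zs [Suc (Suc i)..<Suc n] @ [a, b, vt] @ down zs n
      \<and> uniq (proj {zs i, zs (Suc i)} (U n)) (zs i) (zs (Suc i))"
    by (simp add: U split uniq_abba)
  show "isoterm S (([vx, vy] @ map zs [1..<i]) @ zs i # vT # zs (Suc i) # map zs [Suc (Suc i)..<Suc n] @ [a, b, vt] @ down zs n)"
    using W56_isoterm[OF i ab] i by (simp add: map_upt_snoc map_upt_Cons[OF i(2)] del: upt_Suc)
qed (use sat in \<open>simp_all add: lin_if_xtx[OF W56_xtx] inj_def\<close>)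

end

lemma not_finitely_based_case5:
  fixes S :: "'a::monoid_mult itself"
  assumes "hyp S W56 U5 V5"
  shows "\<not> finitely_based S"
  by (rule W56_not_finitely_based[where U = U5 and V = V5 and a = vy and b = vx])
    (use assms in \<open>simp_all add: hyp_def U5_def V5_def\<close>)

lemma not_finitely_based_case6:
  fixes S :: "'a::monoid_mult itself"
  assumes "hyp S W56 U6 V6"
  shows "\<not> finitely_based S"
  by (rule W56_not_finitely_based[where U = U6 and V = V6 and a = vx and b = vy])
    (use assms in \<open>simp_all add: hyp_def U6_def V6_def\<close>)

section \<open>Case 7\<close>

context
  fixes S :: "'a::monoid_mult itself"
  assumes W: "\<forall>w\<in>W7. isoterm S w"
begin

lemma W7_xtxysy: "distinct [x, t, y, s] \<Longrightarrow> isoterm S [x, t, x, y, s, y]"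
  using W isoterm_rename[of S "[vx, vt1, vx, vy, vt2, vy]" "[vx, vt1, vy, vt2]" "[x, t, y, s]"]
  by (simp add: W7_def)

lemma W7_xyyx: "x \<noteq> y \<Longrightarrow> isoterm S [x, y, y, x]"
  using W isoterm_rename[of S "[vx, vy, vy, vx]" "[vx, vy]" "[x, y]"]
  by (simp add: W7_def)

lemma W7_xyy: "x \<noteq> y \<Longrightarrow> isoterm S [x, y, y]"
  by (rule isoterm_xyyxD(1)[OF W7_xyyx])

lemma W7_xx: "isoterm S [x, x]"
  by (rule isoterm_xyyxD(3)[OF W7_xyyx[of "Suc x" x]]) simp

lemma W7_xtx: "iso_xtx S"
  using iso_xtxI[of S vx "[vy, vy]"] W7_xyyx by simp

text \<open>Inside each palindrome neighbouring letters give \<open>xyyx\<close>. Only the junction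
  of \<open>xs 1\<close> and \<open>ys 1\<close> needs the new letters: its projection
  \<open>xxyy\<close> becomes \<open>x vT x y vT' y\<close>.\<close>

lemma W7_isoterm:
  assumes i: "1 \<le> i" "i < n" and k: "1 \<le> k" "k < n"
  shows "isoterm S (map xs [1..<Suc i] @ vT # map xs [Suc i..<Suc n] @ down xs n
      @ map ys [1..<Suc k] @ vT' # map ys [Suc k..<Suc n] @ down ys n)"
    (is "isoterm S ?w")
proof (rule isoterm_if_adjacent)
  define R where "R = (\<lambda>c d. \<exists>X. c \<in> X \<and> d \<in> X \<and> isoterm S (proj X ?w))"
  have RI: "R c d" if "isoterm S (proj X ?w)" "c \<in> X" "d \<in> X" for c d X
    using that unfolding R_def by blast
  note ps = proj_simps down_def up_def
  have n: "1 \<le> n" "Suc i \<le> n" "Suc k \<le> n" using i k by auto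
  have U: "proj X ?w = proj X (up xs n @ down xs n @ up ys n @ down ys n)" if "vT \<notin> X" "vT' \<notin> X" for X
    using that n by (simp add: up_split[of i n xs] up_split[of k n ys] del: upt_Suc)
  have xx: "R (xs j) (xs (Suc j)) \<and> R (xs (Suc j)) (xs j)" if "1 \<le> j" "Suc j < Suc n" for j
  proof -
    have "isoterm S (proj {xs j, xs (Suc j)} ?w)"
      using that by (subst U) (simp_all add: ps W7_xyyx)
    then show ?thesis using RI by blast
  qed
  have yy: "R (ys j) (ys (Suc j)) \<and> R (ys (Suc j)) (ys j)" if "1 \<le> j" "Suc j < Suc n" for j
  proof -
    have "isoterm S (proj {ys j, ys (Suc j)} ?w)"
      using that by (subst U) (simp_all add: ps W7_xyyx)
    then show ?thesis using RI by blast
  qed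
  have "isoterm S (proj {xs n} ?w)" "isoterm S (proj {ys n} ?w)"
    using n by (subst U; simp add: ps W7_xx)+
  then have n': "R (xs n) (xs n)" "R (ys n) (ys n)"
    using RI by blast+
  have "isoterm S (proj {xs i, vT} ?w)" "isoterm S (proj {xs (Suc i), vT} ?w)"
    "isoterm S (proj {ys k, vT'} ?w)" "isoterm S (proj {ys (Suc k), vT'} ?w)"
    using i k by (simp_all add: ps W7_xyy isoterm_xtx[OF W7_xtx])
  then have T: "R (xs i) vT" "R vT (xs (Suc i))" "R (ys k) vT'" "R vT' (ys (Suc k))"
    using RI by blast+
  have "isoterm S (proj {xs 1, ys 1, vT, vT'} ?w)"
    using i k by (simp add: ps W7_xtxysy)
  then have xy: "R (xs 1) (ys 1)"
    using RI by blast
  have up: "successively R (map xs [k..<l])" "successively R (map ys [k..<l])"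
    if "1 \<le> k" "l \<le> Suc n" for k l
    by (rule successively_map_upt; use xx yy that in auto)+
  have down: "successively R (down xs n)" "successively R (down ys n)"
    unfolding down_def up_def successively_rev
    by (rule successively_map_upt; use xx yy in auto)+
  have hd_last: "hd (down f n) = f n" "last (down f n) = f 1" "down f n \<noteq> []" for f :: "nat \<Rightarrow> nat"
    using n by (simp_all add: down_def up_def hd_rev last_map last_rev hd_map del: upt_Suc)
  show "successively (\<lambda>c d. \<exists>X. c \<in> X \<and> d \<in> X \<and> isoterm S (proj X ?w)) ?w"
    unfolding R_def[symmetric]
    using i k n n' xy T up(1)[of 1 "Suc i"] up(1)[of "Suc i" "Suc n"] up(2)[of 1 "Suc k"] up(2)[of "Suc k" "Suc n"] down
    by (simp add: successively_append_iff successively_Cons hd_map last_map hd_last hd_append del: upt_Suc)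
qed (use i in \<open>simp_all add: lin_if_xtx[OF W7_xtx]\<close>)

end

lemma not_finitely_based_case7:
  fixes S :: "'a::monoid_mult itself"
  assumes "hyp S W7 U7 V7"
  shows "\<not> finitely_based S"
proof (rule not_finitely_based_if_isoterm2[where U = U7 and V = V7
      and c = xs and d = "\<lambda>i. xs (Suc i)" and c' = ys and d' = "\<lambda>i. ys (Suc i)" and T = vT and T' = vT'
      and P = "\<lambda>n i. map xs [1..<i]"
      and M = "\<lambda>n i k. map xs [Suc (Suc i)..<Suc n] @ down xs n @ map ys [1..<k]"
      and Q = "\<lambda>n i. map ys [Suc (Suc i)..<Suc n] @ down ys n"])
  have W: "\<forall>w\<in>W7. isoterm S w" and sat: "\<And>n. 1 < n \<Longrightarrow> satisfies S (U7 n) (V7 n)"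
    using assms by (simp_all add: hyp_def)
  show "satisfies S (U7 n) (V7 n)" if "1 < n" for n
    using sat that .
  show "lin S" using lin_if_xtx[OF W7_xtx[OF W]] .
  show "V7 n \<noteq> [] \<and> V7 n \<noteq> U7 n" if "1 < n" for n
    using that by (auto simp: V7_def U7_def up_def upt_conv_Cons simp del: upt_Suc)
  show "vT \<notin> set (U7 n)" "vT' \<notin> set (U7 n)" for n
    by (auto simp: U7_def up_def down_def)
  fix n i k :: nat assume i: "1 \<le> i" "i < n" and k: "1 \<le> k" "k < n"
  have split: "up f n = map f [1..<i] @ f i # f (Suc i) # map f [Suc (Suc i)..<Suc n]"
    if "1 \<le> i" "i < n" for f :: "nat \<Rightarrow> nat" and i
    using that upt_split[of 1 i "Suc n"] by (simp add: up_def upt_conv_Cons del: upt_Suc)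
  have "proj {xs i, xs (Suc i)} (U7 n) = [xs i, xs (Suc i), xs (Suc i), xs i]"
    "proj {ys k, ys (Suc k)} (U7 n) = [ys k, ys (Suc k), ys (Suc k), ys k]"
    using i k by (simp_all add: U7_def proj_simps up_def down_def del: upt_Suc)
  then have "uniq (proj {xs i, xs (Suc i)} (U7 n)) (xs i) (xs (Suc i))"
    "uniq (proj {ys k, ys (Suc k)} (U7 n)) (ys k) (ys (Suc k))"
    by (simp_all only:) (simp_all add: uniq_abba)
  moreover have "U7 n = map xs [1..<i] @ xs i # xs (Suc i) # (map xs [Suc (Suc i)..<Suc n] @ down xs n @ map ys [1..<k])
        @ ys k # ys (Suc k) # map ys [Suc (Suc k)..<Suc n] @ down ys n"
    by (simp add: U7_def split[OF i, of xs] split[OF k, of ys] del: upt_Suc)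
  ultimately show "U7 n = map xs [1..<i] @ xs i # xs (Suc i) # (map xs [Suc (Suc i)..<Suc n] @ down xs n @ map ys [1..<k])
        @ ys k # ys (Suc k) # map ys [Suc (Suc k)..<Suc n] @ down ys n
      \<and> uniq (proj {xs i, xs (Suc i)} (U7 n)) (xs i) (xs (Suc i))
      \<and> uniq (proj {ys k, ys (Suc k)} (U7 n)) (ys k) (ys (Suc k))"
    by blast
  show "isoterm S (map xs [1..<i] @ xs i # vT # xs (Suc i) # (map xs [Suc (Suc i)..<Suc n] @ down xs n @ map ys [1..<k])
        @ ys k # vT' # ys (Suc k) # map ys [Suc (Suc k)..<Suc n] @ down ys n)"
    using W7_isoterm[OF W i k] i k by (simp add: map_upt_snoc map_upt_Cons[OF i(2)] map_upt_Cons[OF k(2)] del: upt_Suc)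
qed (simp_all add: inj_def)

section \<open>Case 3\<close>

lemma filter_blocks_none: "(\<And>j. filter Q (f j) = []) \<Longrightarrow> filter Q (blocks f n) = []"
  by (simp add: blocks_def filter_concat)

lemma blocks_Suc: "blocks f (Suc n) = blocks f n @ f (Suc n)"
  by (simp add: blocks_def)

lemma filter_blocks_single:
  assumes "1 \<le> i" "i \<le> n" "\<And>j. j \<noteq> i \<Longrightarrow> filter Q (f j) = []"
  shows "filter Q (blocks f n) = filter Q (f i)"
  using assms(1,2)
proof (induction n)
  case (Suc n)
  have "filter Q (blocks f n) = []" if "i = Suc n"
  proof -
    have "\<forall>j\<in>{1..<Suc n}. filter Q (f j) = []" using assms(3) that by auto
    then show ?thesis by (simp add: blocks_def filter_concat del: upt_Suc)
  qed
  then show ?case using Suc assms(3)[of "Suc n"]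
    by (cases "i = Suc n") (auto simp: blocks_Suc)
qed simp

lemma filter_blocks_two:
  assumes "1 \<le> i" "i < k" "k \<le> n" "\<And>j. j \<noteq> i \<Longrightarrow> j \<noteq> k \<Longrightarrow> filter Q (f j) = []"
  shows "filter Q (blocks f n) = filter Q (f i) @ filter Q (f k)"
proof -
  have s: "blocks f n = blocks f i @ concat (map f [Suc i..<Suc n])"
    using upt_split[of 1 "Suc i" "Suc n"] assms(1-3) by (simp add: blocks_def del: upt_Suc)
  have s2: "map f [Suc i..<Suc n] = map f [Suc i..<k] @ f k # map f [Suc k..<Suc n]"
    using upt_split[of "Suc i" k "Suc n"] assms(2,3) by (simp add: upt_conv_Cons del: upt_Suc)
  have "filter Q (concat (map f [Suc i..<k])) = []" "filter Q (concat (map f [Suc k..<Suc n])) = []"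
    using assms(2,4) by (auto simp: filter_concat simp del: upt_Suc)
  moreover have "filter Q (blocks f i) = filter Q (f i)"
  proof -
    have "\<forall>j\<in>{1..<i}. filter Q (f j) = []" using assms(2,4) by auto
    then show ?thesis using assms(1) by (auto simp: blocks_def filter_concat)
  qed
  ultimately show ?thesis unfolding s s2 by simp
qed

lemma blocks_Nil_iff: "(\<And>j. f j \<noteq> []) \<Longrightarrow> blocks f n = [] \<longleftrightarrow> n = 0"
  by (cases n) (auto simp: blocks_Suc, simp add: blocks_def)

lemma hd_blocks: "1 \<le> n \<Longrightarrow> f 1 \<noteq> [] \<Longrightarrow> hd (blocks f n) = hd (f 1)"
  by (simp add: blocks_def upt_conv_Cons del: upt_Suc)

lemma last_blocks: "1 \<le> n \<Longrightarrow> f n \<noteq> [] \<Longrightarrow> last (blocks f n) = last (f n)"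
  by (cases n) (auto simp: blocks_Suc)

lemma successively_blocks:
  assumes "\<And>j. 1 \<le> j \<Longrightarrow> j \<le> n \<Longrightarrow> successively R (f j)" "\<And>j. f j \<noteq> []"
    and "\<And>j. 1 \<le> j \<Longrightarrow> Suc j \<le> n \<Longrightarrow> R (last (f j)) (hd (f (Suc j)))"
  shows "successively R (blocks f n)"
  using assms(1,3)
proof (induction n)
  case (Suc n)
  then show ?case
    by (cases "n = 0") (auto simp: blocks_Suc successively_append_iff last_blocks assms(2), auto simp: blocks_def)
qed (simp add: blocks_def)

lemma uniq_aabb: "a \<noteq> b \<Longrightarrow> uniq [a, a, b, b] a b"
  by (auto simp: uniq_def Cons_eq_append_conv)

text \<open>The linear letters of Case 3 fall into four families by their index modulo 4; naming the
  families confines this arithmetic to their distinctness lemmas.\<close>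

definition ta :: "nat \<Rightarrow> nat" where "ta j = ts (4 * j)"
definition tb :: "nat \<Rightarrow> nat" where "tb j = ts (4 * j + 1)"
definition tc :: "nat \<Rightarrow> nat" where "tc j = ts (4 * j + 2)"
definition td :: "nat \<Rightarrow> nat" where "td j = ts (4 * j + 3)"

lemma t_eq_iff [simp]:
  "ta i = ta j \<longleftrightarrow> i = j" "tb i = tb j \<longleftrightarrow> i = j" "tc i = tc j \<longleftrightarrow> i = j" "td i = td j \<longleftrightarrow> i = j"
  "ta i \<noteq> tb j" "ta i \<noteq> tc j" "ta i \<noteq> td j" "tb i \<noteq> ta j" "tb i \<noteq> tc j" "tb i \<noteq> td j"
  "tc i \<noteq> ta j" "tc i \<noteq> tb j" "tc i \<noteq> td j" "td i \<noteq> ta j" "td i \<noteq> tb j" "td i \<noteq> tc j"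
  unfolding ta_def tb_def tc_def td_def var_eq_iff by presburger+

lemma t_var [simp]:
  "k \<noteq> 9 \<Longrightarrow> ta j \<noteq> var k i" "k \<noteq> 9 \<Longrightarrow> tb j \<noteq> var k i" "k \<noteq> 9 \<Longrightarrow> tc j \<noteq> var k i" "k \<noteq> 9 \<Longrightarrow> td j \<noteq> var k i"
  "k \<noteq> 9 \<Longrightarrow> var k i \<noteq> ta j" "k \<noteq> 9 \<Longrightarrow> var k i \<noteq> tb j" "k \<noteq> 9 \<Longrightarrow> var k i \<noteq> tc j" "k \<noteq> 9 \<Longrightarrow> var k i \<noteq> td j"
  by (auto simp: ta_def tb_def tc_def td_def)

lemma AD3: "A3 n = blocks (\<lambda>j. [zs j, ta j, ps j, tb j]) n" "D3 n = blocks (\<lambda>j. [tc j, qs j, td j, rs j]) n"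
  by (simp_all add: A3_def D3_def ta_def tb_def tc_def td_def)

context
  fixes S :: "'a::monoid_mult itself"
  assumes W: "\<forall>w\<in>W3. isoterm S w"
begin

lemma W3_xtxysy: "distinct [x, t, y, s] \<Longrightarrow> isoterm S [x, t, x, y, s, y]"
  using W isoterm_rename[of S "[vx, vt1, vx, vy, vt2, vy]" "[vx, vt1, vy, vt2]" "[x, t, y, s]"]
  by (simp add: W3_def)

lemma W3_xtx: "iso_xtx S"
  using iso_xtxI[of S vx "[vt1]"] isoterm_append_right[of S "[vx, vt1, vx]" "[vy, vt2, vy]"] W
  by (simp add: W3_def)

lemma W3_xtyxsy: "distinct [x, t, y, s] \<Longrightarrow> isoterm S [x, t, y, x, s, y]"
  using isoterm_xtyxsy[OF W3_xtx] W3_xtxysy by simp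

text \<open>Two adjacent letters that both occur twice give \<open>x t x y s y\<close> or
  \<open>x t y x s y\<close>, provided each has a linear letter between its occurrences. For the
  indexed letters the word supplies these. Between the two \<open>vx\<close>, and between the two
  \<open>vy\<close>, there is none before the insertion; \<open>vT\<close> and \<open>vT'\<close>
  fill these gaps.\<close>

lemma W3_isoterm:
  assumes i: "1 \<le> i" "i \<le> n" and k: "1 \<le> k" "k \<le> n"
  defines "fB \<equiv> \<lambda>j. if j = i then [zs j, vT, qs j] else [zs j, qs j]"
  defines "fC \<equiv> \<lambda>j. if j = k then [ps j, vT', rs j] else [ps j, rs j]"
  shows "isoterm S (A3 n @ [vx] @ blocks fB n @ [vx, vy] @ blocks fC n @ [vy] @ D3 n)"
    (is "isoterm S ?w")
proof (rule isoterm_if_adjacent)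
  define R where "R = (\<lambda>c d. \<exists>X. c \<in> X \<and> d \<in> X \<and> isoterm S (proj X ?w))"
  have RI: "R c d" if "isoterm S (proj X ?w)" "c \<in> X" "d \<in> X" for c d X
    using that unfolding R_def by blast
  note iso = W3_xtxysy W3_xtyxsy isoterm_xtx[OF W3_xtx] isoterm_xtxs[OF W3_xtx] isoterm_txsx[OF W3_xtx]
  note ps = AD3 fB_def fC_def filter_blocks_none iso
  have n: "1 \<le> n" using i by simp
  have b: "R (zs j) (ta j)" "R (ta j) (ps j)" "R (ps j) (tb j)" "R (zs j) (qs j)" "R (ps j) (rs j)"
      "R (tc j) (qs j)" "R (qs j) (td j)" "R (td j) (rs j)"
    if j: "1 \<le> j" "j \<le> n" for j
  proof -
    note s = filter_blocks_single[of j n]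
    have "isoterm S (proj {zs j, ta j} ?w)" "isoterm S (proj {ta j, ps j, tb j} ?w)"
      "isoterm S (proj {ps j, tb j} ?w)" "isoterm S (proj {zs j, qs j, ta j, tc j} ?w)"
      "isoterm S (proj {ps j, rs j, tb j, td j} ?w)" "isoterm S (proj {tc j, qs j} ?w)"
      "isoterm S (proj {qs j, tc j, td j} ?w)" "isoterm S (proj {rs j, td j} ?w)"
      using j by (simp_all add: ps s)
    then show "R (zs j) (ta j)" "R (ta j) (ps j)" "R (ps j) (tb j)" "R (zs j) (qs j)" "R (ps j) (rs j)"
      "R (tc j) (qs j)" "R (qs j) (td j)" "R (td j) (rs j)"
      using RI by blast+
  qed
  have bb: "R (tb j) (zs (Suc j))" "R (qs j) (zs (Suc j))" "R (rs j) (ps (Suc j))" "R (rs j) (tc (Suc j))"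
    if j: "1 \<le> j" "Suc j \<le> n" for j
  proof -
    note s = filter_blocks_two[of j "Suc j" n] filter_blocks_single[of j n] filter_blocks_single[of "Suc j" n]
    have "isoterm S (proj {tb j, zs (Suc j), ta (Suc j)} ?w)"
      "isoterm S (proj {qs j, zs (Suc j), ta (Suc j), tc j} ?w)"
      "isoterm S (proj {rs j, ps (Suc j), tb (Suc j), td j} ?w)"
      "isoterm S (proj {rs j, td j, tc (Suc j)} ?w)"
      using j by (simp_all add: ps s)
    then show "R (tb j) (zs (Suc j))" "R (qs j) (zs (Suc j))" "R (rs j) (ps (Suc j))" "R (rs j) (tc (Suc j))"
      using RI by blast+
  qed
  have T: "R (zs i) vT" "R vT (qs i)" "R (ps k) vT'" "R vT' (rs k)"
  proof -
    note s = filter_blocks_single[of i n] filter_blocks_single[of k n]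
    have "isoterm S (proj {zs i, vT, ta i} ?w)" "isoterm S (proj {qs i, vT, tc i} ?w)"
      "isoterm S (proj {ps k, vT', tb k} ?w)" "isoterm S (proj {rs k, vT', td k} ?w)"
      using i k by (simp_all add: ps s)
    then show "R (zs i) vT" "R vT (qs i)" "R (ps k) vT'" "R vT' (rs k)"
      using RI by blast+
  qed
  have xy: "R (tb n) vx" "R vx (zs 1)" "R (qs n) vx" "R vx vy" "R vy (ps 1)" "R (rs n) vy" "R vy (tc 1)"
  proof -
    note s = filter_blocks_single[of i n] filter_blocks_single[of k n] filter_blocks_single[of 1 n] filter_blocks_single[of n n]
    \<comment> \<open>The block containing \<open>vT\<close> may or may not be the first one; the
      projection is the same in both situations. The next claims split for the same reason.\<close>
    have "isoterm S (proj {vx, zs 1, ta 1, vT} ?w)"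
      using i n by (cases "i = 1") (simp_all add: ps s filter_blocks_two[of 1 i n])
    moreover have "isoterm S (proj {vy, ps 1, tb 1, vT'} ?w)"
      using k n by (cases "k = 1") (simp_all add: ps s filter_blocks_two[of 1 k n])
    moreover have "isoterm S (proj {vx, qs n, tc n, vT} ?w)"
      using i n by (cases "i = n") (simp_all add: ps s filter_blocks_two[of i n n])
    moreover have "isoterm S (proj {vy, rs n, td n, vT'} ?w)"
      using k n by (cases "k = n") (simp_all add: ps s filter_blocks_two[of k n n])
    moreover have "isoterm S (proj {tb n, vx, vT} ?w)" "isoterm S (proj {vx, vy, vT, vT'} ?w)"
      "isoterm S (proj {vy, vT', tc 1} ?w)"
      using i k n by (simp_all add: ps s)
    ultimately show "R (tb n) vx" "R vx (zs 1)" "R (qs n) vx" "R vx vy" "R vy (ps 1)" "R (rs n) vy" "R vy (tc 1)"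
      using RI by blast+
  qed
  have "successively R (A3 n)" "successively R (D3 n)" "successively R (blocks fB n)" "successively R (blocks fC n)"
    using b bb T unfolding AD3 by (auto intro!: successively_blocks simp: fB_def fC_def split: if_splits)
  moreover have "hd (blocks fB n) = zs 1" "last (blocks fB n) = qs n" "hd (blocks fC n) = ps 1"
    "last (blocks fC n) = rs n" "last (A3 n) = tb n" "hd (D3 n) = tc 1"
    using n by (simp_all add: hd_blocks last_blocks AD3 fB_def fC_def)
  moreover have "blocks fB n \<noteq> []" "blocks fC n \<noteq> []"
    using n by (simp_all add: blocks_Nil_iff fB_def fC_def)
  ultimately show "successively (\<lambda>c d. \<exists>X. c \<in> X \<and> d \<in> X \<and> isoterm S (proj X ?w)) ?w"
    unfolding R_def[symmetric] using xy
    by (simp add: successively_append_iff successively_Cons hd_append)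
qed (use i in \<open>simp_all add: lin_if_xtx[OF W3_xtx]\<close>)

end

lemma blocks_split:
  assumes "1 \<le> i" "i \<le> n"
  shows "blocks f n = concat (map f [1..<i]) @ f i @ concat (map f [Suc i..<Suc n])"
  using assms upt_split[of 1 i "Suc n"] by (simp add: blocks_def upt_conv_Cons del: upt_Suc)

lemma not_finitely_based_case3:
  fixes S :: "'a::monoid_mult itself"
  assumes "hyp S W3 U3 V3"
  shows "\<not> finitely_based S"
proof -
  let ?f = "\<lambda>i. [zs i, qs i]" and ?g = "\<lambda>i. [ps i, rs i]"
  let ?P = "\<lambda>n i. A3 n @ [vx] @ concat (map ?f [1..<i])"
  let ?M = "\<lambda>n i k. concat (map ?f [Suc i..<Suc n]) @ [vx, vy] @ concat (map ?g [1..<k])"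
  let ?Q = "\<lambda>n k. concat (map ?g [Suc k..<Suc n]) @ [vy] @ D3 n"
  have W: "\<forall>w\<in>W3. isoterm S w" and sat: "\<And>n. 1 < n \<Longrightarrow> satisfies S (U3 n) (V3 n)"
    using assms by (simp_all add: hyp_def)
  show ?thesis
  proof (rule not_finitely_based_if_isoterm2[where U = U3 and V = V3
      and c = zs and d = qs and c' = ps and d' = rs and T = vT and T' = vT' and P = ?P and M = ?M and Q = ?Q])
    show "satisfies S (U3 n) (V3 n)" if "1 < n" for n
      using sat that .
    show "lin S" using lin_if_xtx[OF W3_xtx[OF W]] .
    show "V3 n \<noteq> [] \<and> V3 n \<noteq> U3 n" for n
      by (simp add: V3_def U3_def)
    show "vT \<notin> set (U3 n)" "vT' \<notin> set (U3 n)" for n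
      by (auto simp: U3_def AD3 B3_def C3_def blocks_def)
    fix n i k :: nat assume i: "1 \<le> i" "i < n" and k: "1 \<le> k" "k < n"
    note s = AD3 B3_def C3_def filter_blocks_none filter_blocks_single[of i n] filter_blocks_single[of k n]
    have "proj {zs i, qs i} (U3 n) = [zs i, zs i, qs i, qs i]" "proj {ps k, rs k} (U3 n) = [ps k, ps k, rs k, rs k]"
      using i k by (simp_all add: U3_def s)
    then have "uniq (proj {zs i, qs i} (U3 n)) (zs i) (qs i)" "uniq (proj {ps k, rs k} (U3 n)) (ps k) (rs k)"
      by (simp_all only:) (simp_all add: uniq_aabb)
    moreover have "U3 n = ?P n i @ zs i # qs i # ?M n i k @ ps k # rs k # ?Q n k"
      using i k by (simp add: U3_def B3_def C3_def blocks_split[of i n ?f] blocks_split[of k n ?g] del: upt_Suc)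
    ultimately show "U3 n = ?P n i @ zs i # qs i # ?M n i k @ ps k # rs k # ?Q n k
      \<and> uniq (proj {zs i, qs i} (U3 n)) (zs i) (qs i) \<and> uniq (proj {ps k, rs k} (U3 n)) (ps k) (rs k)"
      by blast
    let ?fB = "\<lambda>j. if j = i then [zs j, vT, qs j] else [zs j, qs j]"
      and ?fC = "\<lambda>j. if j = k then [ps j, vT', rs j] else [ps j, rs j]"
    have "map ?fB [1..<i] = map ?f [1..<i]" "map ?fB [Suc i..<Suc n] = map ?f [Suc i..<Suc n]"
      "map ?fC [1..<k] = map ?g [1..<k]" "map ?fC [Suc k..<Suc n] = map ?g [Suc k..<Suc n]"
      by (auto simp del: upt_Suc)
    then have "blocks ?fB n = concat (map ?f [1..<i]) @ [zs i, vT, qs i] @ concat (map ?f [Suc i..<Suc n])"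
      "blocks ?fC n = concat (map ?g [1..<k]) @ [ps k, vT', rs k] @ concat (map ?g [Suc k..<Suc n])"
      using i k by (simp_all only: blocks_split[of i n ?fB] blocks_split[of k n ?fC] less_imp_le simp_thms if_True)
    then show "isoterm S (?P n i @ zs i # vT # qs i # ?M n i k @ ps k # vT' # rs k # ?Q n k)"
      using W3_isoterm[OF W i(1) less_imp_le[OF i(2)] k(1) less_imp_le[OF k(2)]] by (simp del: upt_Suc)
  qed (simp_all add: inj_def)
qed

section \<open>Projections preserved by a deduction step\<close>

lemma onceD: "once w c d \<Longrightarrow> w = p @ c # d # q \<Longrightarrow> w = p' @ c # d # q' \<Longrightarrow> p = p' \<and> q = q'"
  unfolding once_def by (metis list.inject same_append_eq)

lemma proj_proj: "X \<subseteq> Y \<Longrightarrow> proj X (proj Y w) = proj X w"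
  by (auto simp: subset_iff intro!: filter_cong)

lemma proj_split:
  assumes "proj X (p @ T # q) = u @ T # v" "T \<in> X" "T \<notin> set u" "T \<notin> set v"
  shows "proj X p = u" "proj X q = v"
  using assms append_Cons_eq_iff[of T u v "proj X p" "proj X q"] by auto

lemma lin_notin:
  assumes "lin S" "satisfies S u w" "T \<notin> set u"
  shows "T \<notin> set w"
  using satisfies_set[OF assms(1,2)] assms(3) by simp

lemma proj_insert_notin: "T \<notin> set w \<Longrightarrow> proj (insert T X) w = proj X w"
  by (auto intro!: filter_cong)

text \<open>Since \<open>T\<close> is linear, the isoterm does more than fix a projection: it
  records which letters of \<open>X\<close> lie left and right of \<open>T\<close>, and the step
  preserves this record.\<close>

lemma isoterm_proj_step:
  assumes "basis S \<Sigma> N" "ded_step \<Sigma> (p @ c # T # d # q) (p' @ T # q')"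
    and T: "T \<notin> set (p @ c # d # q)" "T \<notin> set (p' @ q')"
    and "isoterm S (u @ T # v)" "proj X (p @ [c]) = u" "proj X (d # q) = v"
  shows "proj X p' = u" "proj X q' = v"
proof -
  have "proj (insert T X) (p @ [c]) = u" "proj (insert T X) (d # q) = v"
    using T(1) assms(6,7) proj_insert_notin[of T "p @ [c]" X] proj_insert_notin[of T "d # q" X]
    by (simp_all only: set_append list.set Un_iff insert_iff empty_iff de_Morgan_disj simp_thms)
  then have "proj (insert T X) ((p @ [c]) @ T # (d # q)) = u @ T # v"
    by (simp only: filter_append filter.simps insert_iff simp_thms if_True)
  moreover have "p @ c # T # d # q = (p @ [c]) @ T # (d # q)" by simp
  ultimately have eq: "proj (insert T X) (p' @ T # q') = u @ T # v"
    using isoterm_proj[OF ded_step_satisfies[OF assms(1,2)], of "insert T X"] assms(5) by (simp only:)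
  have "T \<notin> set u" "T \<notin> set v" unfolding assms(6,7)[symmetric] using T(1) by auto
  then have "proj (insert T X) p' = u" "proj (insert T X) q' = v"
    by (rule proj_split[OF eq insertI1])+
  then show "proj X p' = u" "proj X q' = v"
    using T(2) proj_insert_notin[of T p' X] proj_insert_notin[of T q' X] by simp_all
qed

section \<open>Case 1\<close>

text \<open>Suppose \<open>x\<close> comes last. If the other \<open>x\<close> precedes
  \<open>a\<close>, the projection to \<open>x\<close>, \<open>b\<close> is \<open>x b b x\<close>;
  if it follows \<open>a\<close>, the projection to \<open>x\<close>, \<open>a\<close> is
  \<open>a x x\<close>. Both are excluded.\<close>

lemma shuffles_xx_abb:
  assumes "distinct [x, a, b]"
    and "g \<in> shuffles [x, x] [a, b, b]" "proj {x, a} g \<noteq> [a, x, x]" "proj {x, b} g \<noteq> [x, b, b, x]"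
  shows "last (proj {x, b} g) = b"
proof -
  have "x \<noteq> a" "a \<noteq> x" "x \<noteq> b" "b \<noteq> x" "a \<noteq> b" "b \<noteq> a" using assms(1) by auto
  then have "\<forall>g\<in>shuffles [x, x] [a, b, b]. proj {x, a} g \<noteq> [a, x, x] \<longrightarrow> proj {x, b} g \<noteq> [x, b, b, x]
    \<longrightarrow> last (proj {x, b} g) = b" by simp
  then show ?thesis using assms(2-4) by blast
qed

lemma isoterm_xyytx:
  assumes "distinct [x, y, t]" "\<And>x y. x \<noteq> y \<Longrightarrow> isoterm S [x, y, y, x]"
  shows "isoterm S [x, y, y, t, x]"
proof (rule isoterm_if_adjacent)
  have [simp]: "x \<noteq> y" "x \<noteq> t" "y \<noteq> t" "y \<noteq> x" "t \<noteq> x" "t \<noteq> y" using assms(1) by auto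
  have xtx: "iso_xtx S" by (rule iso_xtxI[of S x "[y, y]"]) (use assms(2) in auto)
  then show "lin S" by (rule lin_if_xtx)
  let ?R = "\<lambda>c d. \<exists>X. c \<in> X \<and> d \<in> X \<and> isoterm S (proj X [x, y, y, t, x])"
  have "?R x y" "?R y y" by (rule exI[of _ "{x, y}"]; simp add: assms(2))+
  moreover have "?R y t" by (rule exI[of _ "{y, t}"]) (simp add: isoterm_xyyxD(2)[OF assms(2)])
  moreover have "?R t x" by (rule exI[of _ "{t, x}"]) (simp add: isoterm_xtx[OF xtx])
  ultimately show "successively ?R [x, y, y, t, x]" by simp
qed simp

lemma card_adjacent_pairs: "inj f \<Longrightarrow> card ((\<lambda>i. (f i, g i)) ` {1..<n}) = n - 1"
  by (subst card_image) (auto simp: inj_on_def inj_def)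

text \<open>The word without \<open>vx\<close> is a fixed palindrome, by the isoterms
  \<open>xyyx\<close>. The invariant puts both \<open>vx\<close> before the last
  \<open>ys n\<close>, so a cut in the descending half has both of them on its left. The isoterm
  \<open>x x T\<close> keeps them left of the cut. They could pass the last \<open>ys n\<close> only
  by creating one of two projections of the form \<open>xyyx\<close>, which are isoterms not
  occurring in \<open>U1 n\<close>.\<close>

lemma case1_step:
  fixes S :: "'a::monoid_mult itself"
  assumes W: "\<forall>w\<in>W1. isoterm S w"
    and bas: "basis S \<Sigma> N" and n: "N + 4 < n" "1 < n" and sat: "satisfies S (U1 n) w"
    and I: "last (proj {vx, ys n} w) = ys n" and step: "ded_step \<Sigma> w w'"
  shows "last (proj {vx, ys n} w') = ys n"
proof -
  have xyyx: "isoterm S [x, y, y, x]" if "x \<noteq> y" for x y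
    using W isoterm_rename[of S "[vx, vy, vy, vx]" "[vx, vy]" "[x, y]"] that
    by (simp add: W1_def)
  have xtx: "iso_xtx S" by (rule iso_xtxI[of S vx "[vy, vy]"]) (use xyyx in auto)
  note lin = lin_if_xtx[OF xtx]
  let ?Y = "up ys n @ down ys n"
  have isoY: "isoterm S ?Y"
  proof (rule isoterm_if_adjacent[OF _ lin])
    define R where "R = (\<lambda>c d. \<exists>X. c \<in> X \<and> d \<in> X \<and> isoterm S (proj X ?Y))"
    have RI: "R c d" if "isoterm S (proj X ?Y)" "c \<in> X" "d \<in> X" for c d X
      using that unfolding R_def by blast
    have yy: "R (ys j) (ys (Suc j)) \<and> R (ys (Suc j)) (ys j)" if "1 \<le> j" "Suc j < Suc n" for j
      using RI[of "{ys j, ys (Suc j)}"] that by (simp add: up_def down_def proj_simps xyyx)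
    have "isoterm S (proj {ys n} ?Y)"
      using n by (simp add: up_def down_def proj_simps isoterm_xyyxD(3)[OF xyyx[of vx]])
    then have "R (ys n) (ys n)" using RI by blast
    moreover have "last (up ys n) = ys n" "hd (down ys n) = ys n"
      using n by (simp_all add: down_def up_def hd_rev last_map del: upt_Suc)
    moreover have "successively R (up ys n)" "successively R (down ys n)"
      unfolding down_def up_def successively_rev
      by (rule successively_map_upt; use yy in auto)+
    ultimately show "successively (\<lambda>c d. \<exists>X. c \<in> X \<and> d \<in> X \<and> isoterm S (proj X ?Y)) ?Y"
      unfolding R_def[symmetric] by (simp add: successively_append_iff)
  qed (use n in \<open>simp add: up_def down_def\<close>)
  have projY: "proj (-{vx}) w = ?Y"
    using isoterm_proj[OF sat, of "-{vx}"] isoY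
    by (simp add: U1_def up_def down_def filter_map comp_def filter_rev del: upt_Suc)
  have projx: "proj {vx} w = [vx, vx]"
    using isoterm_proj[OF sat, of "{vx}"] isoterm_xyyxD(3)[OF xyyx[of vy vx]]
    by (simp add: U1_def up_def down_def proj_simps)
  \<comment> \<open>Only the descending half is cut, so that both \<open>ys n\<close> lie left of
    the new letter.\<close>
  let ?F = "(\<lambda>i. (ys (Suc i), ys i)) ` {1..<n}"
  let ?p = "\<lambda>i. up ys n @ rev (map ys [Suc (Suc i)..<Suc n])"
  have splitY: "?Y = ?p i @ ys (Suc i) # ys i # rev (map ys [1..<i])" if "1 \<le> i" "i < n" for i
    using that up_split[of i n ys] by (simp add: down_def map_upt_snoc map_upt_Cons[OF that(2)] del: upt_Suc)
  have onceY: "once ?Y (ys (Suc i)) (ys i)" if "1 \<le> i" "i < n" for i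
  proof (rule onceI[OF splitY[OF that]])
    have "proj {ys (Suc i), ys i} ?Y = [ys i, ys (Suc i), ys (Suc i), ys i]"
      using that by (simp add: proj_simps up_def down_def disj_commute)
    then show "uniq (proj {ys (Suc i), ys i} ?Y) (ys (Suc i)) (ys i)"
      by (simp only:) (auto simp: uniq_def Cons_eq_append_conv)
  qed
  have sub: "?F \<subseteq> adjs (proj (-{vx}) w)"
    unfolding projY by (rule image_subsetI) (rule adjsI[OF splitY]; simp)
  have "card ?F \<le> card (?F \<inter> adjs w) + 2"
    by (rule card_Int_adjs[OF sub]) (use arg_cong[OF projx, of length] in simp)
  moreover have "card ?F = n - 1" by (rule card_adjacent_pairs) (simp add: inj_def)
  ultimately have card: "Suc N < card (?F \<inter> adjs w)" using n by linarith
  have once: "once w c d" if "(c, d) \<in> ?F \<inter> adjs w" for c d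
  proof (rule onceI_proj[of _ _ _ "-{vx}"])
    fix p q p' q' assume "proj (- {vx}) w = p @ c # d # q" "proj (- {vx}) w = p' @ c # d # q'"
    then have "?Y = p @ c # d # q" "?Y = p' @ c # d # q'" unfolding projY by simp_all
    moreover have "once ?Y c d" using that onceY by auto
    ultimately show "length p = length p'" using onceD by blast
  qed (use that in auto)
  obtain c d p q p' q' where *: "(c, d) \<in> ?F \<inter> adjs w" "w = p @ c # d # q" "w' = p' @ q'"
      "ded_step \<Sigma> (p @ c # vT # d # q) (p' @ vT # q')"
    using ded_step_insert[OF bas lin step card once] .
  obtain i where i: "1 \<le> i" "i < n" and cd: "c = ys (Suc i)" "d = ys i" using *(1) by auto
  have "?Y = proj (-{vx}) p @ ys (Suc i) # ys i # proj (-{vx}) q"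
    unfolding projY[symmetric] *(2) cd by simp
  then have p: "proj (-{vx}) p = ?p i" and q: "proj (-{vx}) q = rev (map ys [1..<i])"
    using onceD[OF onceY[OF i] _ splitY[OF i]] by simp_all
  have yp: "proj {ys 1, ys n} (p @ [c]) = [ys 1, ys n, ys n]"
  proof -
    have "proj {ys 1, ys n} p = proj {ys 1, ys n} (?p i)"
      unfolding p[symmetric] by (rule proj_proj[symmetric]) auto
    also have "\<dots> @ proj {ys 1, ys n} [c] = [ys 1, ys n, ys n]"
      using n i by (cases "Suc i = n") (simp_all add: cd up_def proj_simps)
    finally show ?thesis by simp
  qed
  have yq: "proj {ys 1, ys n} (d # q) = [ys 1]"
  proof -
    have "proj {ys 1, ys n} q = proj {ys 1, ys n} (rev (map ys [1..<i]))"
      unfolding q[symmetric] by (rule proj_proj[symmetric]) auto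
    also have "proj {ys 1, ys n} [d] @ \<dots> = [ys 1]"
      using n i by (cases "i = 1") (simp_all add: cd proj_simps)
    moreover have "proj {ys 1, ys n} (d # q) = proj {ys 1, ys n} [d] @ proj {ys 1, ys n} q"
      by simp
    ultimately show ?thesis by (simp only:)
  qed
  have y1n: "ys 1 \<noteq> ys n" "ys n \<noteq> ys 1" using n by simp_all
  have nynq: "ys n \<notin> set (d # q)"
  proof
    assume "ys n \<in> set (d # q)"
    then have "ys n \<in> set (proj {ys 1, ys n} (d # q))"
      by (simp only: set_filter mem_Collect_eq insert_iff simp_thms)
    then show False unfolding yq using y1n by simp
  qed
  have xq: "vx \<notin> set q"
  proof
    assume "vx \<in> set q"
    then have "proj {vx, ys n} q \<noteq> []" by (auto simp: filter_empty_conv)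
    moreover have "w = (p @ [c, d]) @ q" using *(2) by simp
    then have "proj {vx, ys n} w = proj {vx, ys n} (p @ [c, d]) @ proj {vx, ys n} q"
      by (simp only: filter_append)
    ultimately have "ys n \<in> set (proj {vx, ys n} q)"
      using I by (metis last_appendR last_in_set)
    then show False using nynq by simp
  qed
  then have xq': "proj {vx} q = []" by (auto simp: filter_empty_conv)
  then have xp: "proj {vx} p = [vx, vx]"
    using projx *(2) cd by simp
  have T: "vT \<notin> set w" by (rule lin_notin[OF lin sat]) (auto simp: U1_def up_def down_def)
  then have T: "vT \<notin> set (p @ c # d # q)" "vT \<notin> set (p' @ q')"
    using lin_notin[OF lin ded_step_satisfies[OF bas step]] *(2,3) by simp_all
  have x'': "proj {vx} p' = [vx, vx]" "proj {vx} q' = []"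
    by (rule isoterm_proj_step[OF bas *(4) T];
        use isoterm_xyyxD(2)[OF xyyx[of vT vx]] xp xq' cd in simp)+
  have iso: "isoterm S ([ys 1, ys n, ys n] @ vT # [ys 1])"
    using isoterm_xyytx[OF _ xyyx, of "ys 1" "ys n" vT] n by simp
  note y'' = isoterm_proj_step[OF bas *(4) T iso yp yq]
  let ?g = "proj {vx, ys 1, ys n} p'"
  have nx: "vx \<notin> set q'" using x''(2) by (auto simp: filter_empty_conv)
  have q1: "proj {vx, ys 1} q' = [ys 1]"
  proof -
    have "proj {vx, ys 1} q' = proj {ys 1} q'" using nx by (auto intro!: filter_cong)
    also have "\<dots> = proj {ys 1} (proj {ys 1, ys n} q')" by (rule proj_proj[symmetric]) simp
    finally show ?thesis unfolding y''(2) by simp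
  qed
  have qn: "proj {vx, ys n} q' = []"
  proof -
    have "proj {vx, ys n} q' = proj {ys n} q'" using nx by (auto intro!: filter_cong)
    also have "\<dots> = proj {ys n} (proj {ys 1, ys n} q')" by (rule proj_proj[symmetric]) simp
    finally show ?thesis unfolding y''(2) using y1n by simp
  qed
  have g1: "proj {vx, ys 1} ?g = proj {vx, ys 1} p'" and gn: "proj {vx, ys n} ?g = proj {vx, ys n} p'"
    by (rule proj_proj; simp)+
  have sat': "satisfies S (U1 n) w'"
    using satisfies_trans[OF sat ded_step_satisfies[OF bas step]] .
  have "distinct [vx, ys 1, ys n]" using n by simp
  note last = shuffles_xx_abb[OF this]
  have "?g \<in> shuffles (proj {vx} ?g) (proj {ys 1, ys n} ?g)"
    by (rule in_shuffles_proj) auto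
  moreover have "proj {vx} ?g = [vx, vx]"
    unfolding x''(1)[symmetric] by (rule proj_proj) simp
  moreover have "proj {ys 1, ys n} ?g = [ys 1, ys n, ys n]"
    unfolding y''(1)[symmetric] by (rule proj_proj) simp
  ultimately have "?g \<in> shuffles [vx, vx] [ys 1, ys n, ys n]"
    by (simp only:)
  \<comment> \<open>Together with the \<open>ys 1\<close> right of the cut this would be
    \<open>ys 1 vx vx ys 1\<close>, an isoterm; but \<open>U1 n\<close> begins with
    \<open>vx\<close>.\<close>
  moreover have "proj {vx, ys 1} ?g \<noteq> [ys 1, vx, vx]"
  proof
    assume "proj {vx, ys 1} ?g = [ys 1, vx, vx]"
    then have "proj {vx, ys 1} w' = [ys 1, vx, vx, ys 1]"
      unfolding g1 *(3) filter_append q1 by simp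
    then have "proj {vx, ys 1} (U1 n) = [ys 1, vx, vx, ys 1]"
      using isoterm_proj_right[OF sat', of "{vx, ys 1}"] xyyx[of "ys 1" vx] by simp
    then show False by (simp add: U1_def)
  qed
  moreover have "proj {vx, ys n} ?g \<noteq> [vx, ys n, ys n, vx]"
  proof
    assume "proj {vx, ys n} ?g = [vx, ys n, ys n, vx]"
    then have "proj {vx, ys n} w' = [vx, ys n, ys n, vx]"
      unfolding gn *(3) filter_append qn by simp
    then have "proj {vx, ys n} (U1 n) = [vx, ys n, ys n, vx]"
      using isoterm_proj_right[OF sat', of "{vx, ys n}"] xyyx[of vx "ys n"] by simp
    then show False using n by (simp add: U1_def up_def down_def proj_simps)
  qed
  ultimately have "last (proj {vx, ys n} ?g) = ys n"
    by (rule last)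
  then show ?thesis
    unfolding gn *(3) filter_append qn by simp
qed

lemma not_finitely_based_case1:
  fixes S :: "'a::monoid_mult itself"
  assumes "hyp S W1 U1 V1"
  shows "\<not> finitely_based S"
proof (rule not_finitely_based_if_invariant[where U = U1 and V = V1 and k = 4
      and I = "\<lambda>n w. last (proj {vx, ys n} w) = ys n"])
  show "last (proj {vx, ys n} (U1 n)) = ys n" "last (proj {vx, ys n} (V1 n)) \<noteq> ys n" if "1 < n" for n
    using that by (simp_all add: U1_def V1_def up_def down_def proj_simps)
next
  fix \<Sigma> N n w w'
  assume "basis S \<Sigma> N" "N + 4 < n" "1 < n" "satisfies S (U1 n) w"
    "last (proj {vx, ys n} w) = ys n" "ded_step \<Sigma> w w'"
  then show "last (proj {vx, ys n} w') = ys n"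
    using case1_step assms unfolding hyp_def by blast
qed (use assms in \<open>simp_all add: hyp_def U1_def V1_def\<close>)

lemma proj_minus_proj: "X \<inter> Y = {} \<Longrightarrow> proj X (proj (-Y) w) = proj X w"
  by (auto intro!: filter_cong)

lemma append_eq_snoc2:
  assumes "p @ q = u @ [a, b]" "q \<noteq> []" "a \<notin> set q"
  shows "p = u @ [a]" "q = [b]"
proof -
  obtain q' c where q: "q = q' @ [c]" using assms(2) by (cases q rule: rev_cases) auto
  then have eq: "p @ q' = u @ [a]" "c = b" using assms(1) by auto
  then have "q' = []" using assms(3) q by (cases q' rule: rev_cases) auto
  then show "p = u @ [a]" "q = [b]" using eq q by simp_all
qed

section \<open>Cutting inside squares, for Cases 4 and 8\<close>

lemma uniq_aa: "uniq [a, a] a a"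
  by (auto simp: uniq_def Cons_eq_append_conv)

lemma once_diagonal:
  assumes "proj {a} w = [a, a]" "(a, a) \<in> adjs w"
  shows "once w a a"
proof (rule onceI_proj[OF assms(2), of "{a}"])
  fix p q p' q' assume "proj {a} w = p @ a # a # q" "proj {a} w = p' @ a # a # q'"
  then show "length p = length p'"
    using uniq_aa[of a] unfolding assms(1) uniq_def by blast
qed simp_all

lemma squares_subset_adjs:
  "(\<lambda>i. (f i, f i)) ` {1..<n} \<subseteq> adjs (a @ blocks (\<lambda>i. [f i, f i]) n @ b)"
proof (rule image_subsetI)
  fix i assume "i \<in> {1..<n}"
  then have i: "1 \<le> i" "i \<le> n" by auto
  show "(f i, f i) \<in> adjs (a @ blocks (\<lambda>i. [f i, f i]) n @ b)"
    unfolding blocks_split[OF i]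
    by (rule adjsI[of _ "a @ concat (map (\<lambda>i. [f i, f i]) [1..<i])" _ _ "concat (map (\<lambda>i. [f i, f i]) [Suc i..<Suc n]) @ b"]) simp
qed

text \<open>Each \<open>f i\<close> occurs exactly twice, so its square occurs at most once. Of the
  \<open>n - 1\<close> squares considered, the letters \<open>x\<close> break at most
  \<open>k\<close>, and \<open>N + k + 2 < n\<close> leaves more than \<open>N + 1\<close>.\<close>

lemma ded_step_insert_squares:
  fixes S :: "'a::monoid_mult itself"
  assumes bas: "basis S \<Sigma> N" and lin: "lin S" and step: "ded_step \<Sigma> w w'"
    and n: "N + k + 2 < n" and inj: "inj f"
    and x: "length (proj {x} w) \<le> k" and w: "proj (-{x}) w = a @ blocks (\<lambda>i. [f i, f i]) n @ b"
    and sq: "\<And>i. 1 \<le> i \<Longrightarrow> i \<le> n \<Longrightarrow> proj {f i} w = [f i, f i]"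
  obtains i p q p' q' where "1 \<le> i" "i \<le> n" "w = p @ f i # f i # q" "w' = p' @ q'"
    "ded_step \<Sigma> (p @ f i # T # f i # q) (p' @ T # q')"
proof -
  let ?F = "(\<lambda>i. (f i, f i)) ` {1..<n}"
  have sub: "?F \<subseteq> adjs (proj (-{x}) w)"
    unfolding w by (rule squares_subset_adjs)
  have "card ?F \<le> card (?F \<inter> adjs w) + k"
    by (rule card_Int_adjs[OF sub]) (use x in simp)
  moreover have "card ?F = n - 1" using inj by (rule card_adjacent_pairs)
  ultimately have card: "Suc N < card (?F \<inter> adjs w)" using n by linarith
  have once: "once w c d" if cd: "(c, d) \<in> ?F \<inter> adjs w" for c d
  proof -
    obtain i where "i \<in> {1..<n}" "c = f i" "d = f i" using cd by auto
    then show ?thesis using once_diagonal[OF sq[of i]] cd by auto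
  qed
  obtain c d p q p' q' where *: "(c, d) \<in> ?F \<inter> adjs w" "w = p @ c # d # q" "w' = p' @ q'"
      "ded_step \<Sigma> (p @ c # T # d # q) (p' @ T # q')"
    using ded_step_insert[OF bas lin step card once] .
  then obtain i where "i \<in> {1..<n}" "c = f i" "d = f i" by auto
  then show ?thesis using that[of i p q p' q'] * by simp
qed

section \<open>Case 4\<close>

text \<open>Without \<open>vx\<close> the word is fixed. The square \<open>zs i zs i\<close> that is
  cut lies between the second \<open>vy\<close> and the last \<open>vx\<close>, so the invariant
  projection acquires a second linear letter and becomes the pattern \<open>x y t1 y t2 x\<close> of
  \<open>W4\<close>.\<close>

lemma case4_step:
  fixes S :: "'a::monoid_mult itself"
  assumes W: "\<forall>w\<in>W4. isoterm S w"
    and bas: "basis S \<Sigma> N" and n: "N + 4 < n" "1 < n" and sat: "satisfies S (U4 n) w"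
    and I: "proj {vx, vy, vt} w = [vx, vy, vt, vy, vx]" and step: "ded_step \<Sigma> w w'"
  shows "proj {vx, vy, vt} w' = [vx, vy, vt, vy, vx]"
proof -
  have xxyy: "isoterm S [x, x, y, y]" if "x \<noteq> y" for x y
    using W isoterm_rename[of S "[vx, vx, vy, vy]" "[vx, vy]" "[x, y]"] that
    by (simp add: W4_def)
  have xytysx: "isoterm S [x, y, t, y, s, x]" if "distinct [x, y, t, s]" for x y t s
    using W isoterm_rename[of S "[vx, vy, vt1, vy, vt2, vx]" "[vx, vy, vt1, vt2]" "[x, y, t, s]"] that
    by (simp add: W4_def)
  have xtx: "iso_xtx S"
    by (rule iso_xtxI[of S vx "[vy, vt1, vy, vt2]"]) (use xytysx in auto)
  note lin = lin_if_xtx[OF xtx]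
  have xx: "isoterm S [x, x]" for x
    using isoterm_append_right[of S "[x, x]" "[Suc x, Suc x]"] xxyy by simp
  let ?b = "\<lambda>i. [zs i, zs i]"
  let ?Y = "[vy, vt, vy] @ blocks ?b n"
  note s = filter_blocks_none filter_blocks_single
  have isoY: "isoterm S ?Y"
  proof (rule isoterm_if_adjacent[OF _ lin])
    define R where "R = (\<lambda>c d. \<exists>X. c \<in> X \<and> d \<in> X \<and> isoterm S (proj X ?Y))"
    have RI: "R c d" if "isoterm S (proj X ?Y)" "c \<in> X" "d \<in> X" for c d X
      using that unfolding R_def by blast
    have z: "R (zs j) (zs j)" if "1 \<le> j" "j \<le> n" for j
      using RI[of "{zs j}"] that by (simp add: s(1) s(2)[of j n] xx)
    have zz: "R (zs j) (zs (Suc j))" if "1 \<le> j" "Suc j \<le> n" for j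
      using RI[of "{zs j, zs (Suc j)}"] that by (simp add: s(1) filter_blocks_two[of j "Suc j" n] xxyy)
    have "R vy (zs 1)" "R vy vt" "R vt vy"
      using RI[of "{vy, zs 1}"] RI[of "{vy, vt}"] n
      by (simp_all add: s(1) s(2)[of 1 n] xxyy isoterm_xtx[OF xtx])
    moreover have "successively R (blocks ?b n)"
      by (rule successively_blocks) (use z zz in auto)
    ultimately show "successively (\<lambda>c d. \<exists>X. c \<in> X \<and> d \<in> X \<and> isoterm S (proj X ?Y)) ?Y"
      unfolding R_def[symmetric] using n by (simp add: successively_Cons hd_blocks)
  qed simp
  have "proj (-{vx}) (U4 n) = ?Y"
    by (simp add: U4_def blocks_def filter_concat comp_def)
  then have projY: "proj (-{vx}) w = ?Y"
    using isoterm_proj[OF sat, of "-{vx}"] isoY by simp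
  have sub: "proj X w = proj X ?Y" if "vx \<notin> X" for X
    unfolding projY[symmetric] by (rule proj_minus_proj[symmetric]) (use that in auto)
  have sq: "proj {zs i} w = [zs i, zs i]" if "1 \<le> i" "i \<le> n" for i
    by (subst sub) (use that in \<open>simp_all add: s(1) s(2)[of i n]\<close>)
  have x: "proj {vx} w = [vx, vx]"
    using arg_cong[OF I, of "proj {vx}"] proj_proj[of "{vx}" "{vx, vy, vt}" w] by simp
  have "N + 2 + 2 < n" "inj zs" "length (proj {vx} w) \<le> 2" "proj (-{vx}) w = [vy, vt, vy] @ blocks ?b n @ []"
    using n x projY by (simp_all only: inj_def var_eq_iff) simp_all
  note insert = ded_step_insert_squares[OF bas lin step this sq, of vT]
  obtain i p q p' q' where i: "1 \<le> i" "i \<le> n" and w: "w = p @ zs i # zs i # q" and w': "w' = p' @ q'"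
    and step': "ded_step \<Sigma> (p @ zs i # vT # zs i # q) (p' @ vT # q')"
    using insert by blast
  have T: "vT \<notin> set w"
    by (rule lin_notin[OF lin sat]) (auto simp: U4_def blocks_def)
  have "proj {vy, vt, zs i} w = [vy, vt, vy, zs i, zs i]"
    by (subst sub) (use i in \<open>simp_all add: s(1) s(2)[of i n]\<close>)
  then have "proj {vy, vt, zs i} p @ zs i # zs i # proj {vy, vt, zs i} q = [vy, vt, vy, zs i, zs i]"
    unfolding w by simp
  then have q: "proj {vy, vt, zs i} q = []"
    by (auto simp: append_eq_Cons_conv)
  have pq: "proj {vx, vy, vt} p @ proj {vx, vy, vt} q = [vx, vy, vt, vy, vx]"
    using I unfolding w by simp
  \<comment> \<open>Otherwise both \<open>vx\<close> precede both \<open>zs i\<close>. Then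
    \<open>xxzz\<close> is an isoterm among the projections, whereas \<open>U4 n\<close> projects to
    \<open>xzzx\<close>.\<close>
  have "vx \<in> set q"
  proof (rule ccontr)
    assume "vx \<notin> set q"
    then have "proj {vx} q = []" by (auto simp: filter_empty_conv)
    then have "proj {vx, zs i} q = []" using q by (auto simp: filter_empty_conv)
    moreover have "zs i \<notin> set p"
      using sq[OF i] unfolding w by (auto simp: filter_empty_conv append_eq_Cons_conv)
    then have "proj {vx, zs i} p = proj {vx} p" by (auto intro!: filter_cong)
    moreover have "proj {vx} p = [vx, vx]"
      using x \<open>proj {vx} q = []\<close> unfolding w by simp
    ultimately have "proj {vx, zs i} w = [vx, vx, zs i, zs i]"
      unfolding w by simp
    then have "proj {vx, zs i} (U4 n) = [vx, vx, zs i, zs i]"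
      using isoterm_proj_right[OF sat, of "{vx, zs i}"] xxyy by simp
    then show False using i by (simp add: U4_def s(1) s(2)[of i n])
  qed
  then have ne: "proj {vx, vy, vt} q \<noteq> []" "vy \<notin> set (proj {vx, vy, vt} q)"
    using q by (auto simp: filter_empty_conv)
  have p1: "proj {vx, vy, vt} p = [vx, vy, vt, vy]" and q1: "proj {vx, vy, vt} q = [vx]"
    using append_eq_snoc2[OF _ ne, of "proj {vx, vy, vt} p" "[vx, vy, vt]" vx] pq by simp_all
  have iso: "isoterm S ([vx, vy, vt, vy] @ vT # [vx])" using xytysx by simp
  have T': "vT \<notin> set (p @ zs i # zs i # q)" "vT \<notin> set (p' @ q')"
    using T lin_notin[OF lin ded_step_satisfies[OF bas step] T] unfolding w w' by simp_all
  have "proj {vx, vy, vt} p' = [vx, vy, vt, vy]" "proj {vx, vy, vt} q' = [vx]"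
    by (rule isoterm_proj_step[OF bas step' T' iso]; use p1 q1 in simp)+
  then show ?thesis unfolding w' by simp
qed

lemma not_finitely_based_case4:
  fixes S :: "'a::monoid_mult itself"
  assumes "hyp S W4 U4 V4"
  shows "\<not> finitely_based S"
proof (rule not_finitely_based_if_invariant[where U = U4 and V = V4 and k = 4
      and I = "\<lambda>n w. proj {vx, vy, vt} w = [vx, vy, vt, vy, vx]"])
  show "proj {vx, vy, vt} (U4 n) = [vx, vy, vt, vy, vx]" "proj {vx, vy, vt} (V4 n) \<noteq> [vx, vy, vt, vy, vx]" for n
    by (simp_all add: U4_def V4_def filter_blocks_none)
next
  fix \<Sigma> N n w w'
  assume "basis S \<Sigma> N" "N + 4 < n" "1 < n" "satisfies S (U4 n) w"
    "proj {vx, vy, vt} w = [vx, vy, vt, vy, vx]" "ded_step \<Sigma> w w'"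
  then show "proj {vx, vy, vt} w' = [vx, vy, vt, vy, vx]"
    using case4_step assms unfolding hyp_def by blast
qed (use assms in \<open>simp_all add: hyp_def U4_def V4_def\<close>)

section \<open>Case 8\<close>

lemma successively_replicate: "R x x \<Longrightarrow> successively R (replicate n x)"
proof (induction n)
  case (Suc n)
  then show ?case by (cases n) auto
qed simp

lemma proj_singleton: "proj {x} w = replicate (length (proj {x} w)) x"
  by (intro replicate_length_same[symmetric]) auto

text \<open>The two negative conditions say that some \<open>vx\<close> precedes the second
  \<open>vy\<close> and some \<open>vx\<close> follows the first \<open>vz\<close>. As the cut
  square lies between these places, there are \<open>vx\<close> on both sides of the new letter, and
  their numbers \<open>d\<close> and \<open>e\<close> are kept by the isoterm
  \<open>x^d T x^e\<close>. If a condition failed after the step, a pattern of \<open>W8\<close>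
  with \<open>T\<close> in the role of \<open>t2\<close> or \<open>t1\<close> would appear, and by
  the isoterm property the condition would have failed before.\<close>

lemma case8_step:
  fixes S :: "'a::monoid_mult itself"
  assumes m: "m > 2" and W: "\<forall>w\<in>W8 m. isoterm S w"
    and bas: "basis S \<Sigma> N" and n: "N + (m + 2) < n" "1 < n" and sat: "satisfies S (U8 m n) w"
    and Ix: "proj {vx} w = replicate m vx" and Iy: "\<nexists>r. proj {vx, vy} w = [vy, vy] @ r"
    and Iz: "\<nexists>r. proj {vx, vz} w = r @ [vz, vz]" and step: "ded_step \<Sigma> w w'"
  shows "proj {vx} w' = replicate m vx" "\<nexists>r. proj {vx, vy} w' = [vy, vy] @ r" "\<nexists>r. proj {vx, vz} w' = r @ [vz, vz]"
proof -
  have xxyy: "isoterm S [x, x, y, y]" if "x \<noteq> y" for x y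
    using W isoterm_rename[of S "[vx, vx, vy, vy]" "[vx, vy]" "[x, y]"] that
    by (simp add: W8_def)
  have L: "isoterm S ([y, t, y] @ replicate d x @ [s] @ replicate e x)"
    if "distinct [y, t, x, s]" "0 < d" "0 < e" "d + e = m" for y t x s d e
  proof -
    have "0 < d" "d < m" using that by auto
    then have "[vy, vt1, vy] @ replicate d vx @ [vt2] @ replicate (m - d) vx \<in> W8 m"
      unfolding W8_def by blast
    moreover have "m - d = e" using that by simp
    ultimately have "isoterm S ([vy, vt1, vy] @ replicate d vx @ [vt2] @ replicate e vx)"
      using W by metis
    then show ?thesis
      using isoterm_rename[of S _ "[vy, vt1, vx, vt2]" "[y, t, x, s]"] that(1) by force
  qed
  have M: "isoterm S (replicate d x @ [t] @ replicate e x @ [y, s, y])"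
    if "distinct [y, t, x, s]" "0 < d" "0 < e" "d + e = m" for y t x s d e
  proof -
    have "0 < e" "e < m" using that by auto
    then have "replicate (m - e) vx @ [vt1] @ replicate e vx @ [vy, vt2, vy] \<in> W8 m"
      unfolding W8_def by blast
    moreover have "m - e = d" using that by simp
    ultimately have "isoterm S (replicate d vx @ [vt1] @ replicate e vx @ [vy, vt2, vy])"
      using W by metis
    then show ?thesis
      using isoterm_rename[of S _ "[vy, vt1, vx, vt2]" "[y, t, x, s]"] that(1) by force
  qed
  have xtx: "iso_xtx S"
  proof (rule iso_xtxI)
    show "isoterm S (vy # [vt1] @ [vy])"
      using isoterm_append_right[of S "[vy, vt1, vy]" "replicate 1 vx @ [vt2] @ replicate (m - 1) vx"]
        L[of vy vt1 vx vt2 1 "m - 1"] m by simp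
  qed simp_all
  note lin = lin_if_xtx[OF xtx]
  have xx: "isoterm S [x, x]" for x
    using isoterm_append_right[of S "[x, x]" "[Suc x, Suc x]"] xxyy by simp
  let ?b = "\<lambda>i. [ps i, ps i]"
  let ?Y = "[vy, vt1, vy] @ blocks ?b n @ [vz, vt2, vz]"
  note s = filter_blocks_none filter_blocks_single
  have isoY: "isoterm S ?Y"
  proof (rule isoterm_if_adjacent[OF _ lin])
    define R where "R = (\<lambda>c d. \<exists>X. c \<in> X \<and> d \<in> X \<and> isoterm S (proj X ?Y))"
    have RI: "R c d" if "isoterm S (proj X ?Y)" "c \<in> X" "d \<in> X" for c d X
      using that unfolding R_def by blast
    have z: "R (ps j) (ps j)" if "1 \<le> j" "j \<le> n" for j
      using RI[of "{ps j}"] that by (simp add: s(1) s(2)[of j n] xx)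
    have zz: "R (ps j) (ps (Suc j))" if "1 \<le> j" "Suc j \<le> n" for j
      using RI[of "{ps j, ps (Suc j)}"] that by (simp add: s(1) filter_blocks_two[of j "Suc j" n] xxyy)
    have "R vy (ps 1)" "R vy vt1" "R vt1 vy" "R (ps n) vz" "R vz vt2" "R vt2 vz"
      using RI[of "{vy, ps 1}"] RI[of "{vy, vt1}"] RI[of "{vz, ps n}"] RI[of "{vz, vt2}"] n
      by (simp_all add: s(1) s(2)[of 1 n] s(2)[of n n] xxyy isoterm_xtx[OF xtx])
    moreover have "successively R (blocks ?b n)"
      by (rule successively_blocks) (use z zz in auto)
    ultimately show "successively (\<lambda>c d. \<exists>X. c \<in> X \<and> d \<in> X \<and> isoterm S (proj X ?Y)) ?Y"
      unfolding R_def[symmetric] using n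
      by (simp add: successively_Cons successively_append_iff hd_append hd_blocks last_blocks blocks_Nil_iff)
  qed simp
  have "proj (-{vx}) (U8 m n) = ?Y"
    by (simp add: U8_def blocks_def filter_concat comp_def)
  then have projY: "proj (-{vx}) w = ?Y"
    using isoterm_proj[OF sat, of "-{vx}"] isoY by simp
  have sub: "proj X w = proj X ?Y" if "vx \<notin> X" for X
    unfolding projY[symmetric] by (rule proj_minus_proj[symmetric]) (use that in auto)
  have sq: "proj {ps i} w = [ps i, ps i]" if "1 \<le> i" "i \<le> n" for i
    by (subst sub) (use that in \<open>simp_all add: s(1) s(2)[of i n]\<close>)
  have "N + m + 2 < n" "inj ps" "length (proj {vx} w) \<le> m"
    using n Ix by (simp_all only: inj_def var_eq_iff) simp_all
  note insert = ded_step_insert_squares[OF bas lin step this projY sq, of vT]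
  obtain i p q p' q' where i: "1 \<le> i" "i \<le> n" and w: "w = p @ ps i # ps i # q" and w': "w' = p' @ q'"
    and step': "ded_step \<Sigma> (p @ ps i # vT # ps i # q) (p' @ vT # q')"
    using insert by blast
  have T: "vT \<notin> set w"
    by (rule lin_notin[OF lin sat]) (auto simp: U8_def blocks_def)
  have T': "vT \<notin> set (p @ ps i # ps i # q)" "vT \<notin> set (p' @ q')"
    using T lin_notin[OF lin ded_step_satisfies[OF bas step] T] unfolding w w' by simp_all
  note proj_step = isoterm_proj_step[OF bas step' T']
  have yp: "proj {vy, vt1} p = [vy, vt1, vy]" "proj {vy, vt1} q = []"
  proof -
    have "proj {vy, vt1, ps i} w = [vy, vt1, vy, ps i, ps i]"
      by (subst sub) (use i in \<open>simp_all add: s(1) s(2)[of i n]\<close>)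
    then have "proj {vy, vt1, ps i} p @ ps i # ps i # proj {vy, vt1, ps i} q = [vy, vt1, vy, ps i, ps i]"
      unfolding w by simp
    then have "proj {vy, vt1, ps i} p = [vy, vt1, vy] \<and> proj {vy, vt1, ps i} q = []"
      by (auto simp: append_eq_Cons_conv)
    then show "proj {vy, vt1} p = [vy, vt1, vy]" "proj {vy, vt1} q = []"
      using proj_proj[of "{vy, vt1}" "{vy, vt1, ps i}" p, symmetric]
        proj_proj[of "{vy, vt1}" "{vy, vt1, ps i}" q, symmetric] by (simp_all only: subset_insertI) simp_all
  qed
  have zq: "proj {vz, vt2} p = []" "proj {vz, vt2} q = [vz, vt2, vz]"
  proof -
    have "proj {vz, vt2, ps i} w = [ps i, ps i, vz, vt2, vz]"
      by (subst sub) (use i in \<open>simp_all add: s(1) s(2)[of i n]\<close>)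
    then have "proj {vz, vt2, ps i} p @ ps i # ps i # proj {vz, vt2, ps i} q = [ps i, ps i, vz, vt2, vz]"
      unfolding w by simp
    then have "proj {vz, vt2, ps i} p = [] \<and> proj {vz, vt2, ps i} q = [vz, vt2, vz]"
      by (auto simp: append_eq_Cons_conv)
    then show "proj {vz, vt2} p = []" "proj {vz, vt2} q = [vz, vt2, vz]"
      using proj_proj[of "{vz, vt2}" "{vz, vt2, ps i}" p, symmetric]
        proj_proj[of "{vz, vt2}" "{vz, vt2, ps i}" q, symmetric] by (simp_all only: subset_insertI) simp_all
  qed
  define d e where "d = length (proj {vx} p)" and "e = length (proj {vx} q)"
  have xp: "proj {vx} p = replicate d vx" and xq: "proj {vx} q = replicate e vx"
    unfolding d_def e_def by (rule proj_singleton)+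
  have de: "d + e = m"
    using arg_cong[OF Ix, of length] unfolding w d_def e_def by simp
  have sub1: "proj {a} u = proj {a} (proj {a, b} u)" for a b :: nat and u
    by (rule proj_proj[symmetric]) simp
  have d0: "0 < d"
  proof (rule ccontr)
    assume "\<not> 0 < d"
    then have "vx \<notin> set p" using xp by (auto simp: filter_empty_conv)
    then have "proj {vx, vy} p = proj {vy} p" by (auto intro!: filter_cong)
    also have "\<dots> = [vy, vy]" unfolding sub1[of vy p vt1] yp by simp
    finally show False using Iy unfolding w by simp
  qed
  have e0: "0 < e"
  proof (rule ccontr)
    assume "\<not> 0 < e"
    then have "vx \<notin> set q" using xq by (auto simp: filter_empty_conv)
    then have "proj {vx, vz} q = proj {vz} q" by (auto intro!: filter_cong)
    also have "\<dots> = [vz, vz]" unfolding sub1[of vz q vt2] zq by simp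
    finally show False using Iz unfolding w by simp
  qed
  \<comment> \<open>A factor of the pattern \<open>y t1 y x^d t2 x^e\<close>, which is available as
    \<open>d\<close> and \<open>e\<close> are positive with sum \<open>m\<close>.\<close>
  have iso: "isoterm S (replicate d vx @ vT # replicate e vx)"
    using isoterm_append_left[of S "[vy, vt1, vy]"] L[of vy vt1 vx vT d e] d0 e0 de by simp
  have x': "proj {vx} p' = replicate d vx" "proj {vx} q' = replicate e vx"
    by (rule proj_step[OF iso]; use xp xq in simp)+
  show "proj {vx} w' = replicate m vx"
    unfolding w' filter_append x' de[symmetric] replicate_add ..
  have y': "proj {vy, vt1} p' = [vy, vt1, vy]" "proj {vy, vt1} q' = []"
    by (rule proj_step[of "[vy, vt1, vy]" "[]"]; use yp isoterm_xtxs[OF xtx, of vy vt1 vT] in simp)+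
  have z': "proj {vz, vt2} p' = []" "proj {vz, vt2} q' = [vz, vt2, vz]"
    by (rule proj_step[of "[]" "[vz, vt2, vz]"]; use zq isoterm_txsx[OF xtx, of vz vT vt2] in simp)+
  let ?w = "p @ ps i # vT # ps i # q" and ?w' = "p' @ vT # q'"
  have sat': "satisfies S ?w ?w'" by (rule ded_step_satisfies[OF bas step'])
  have xT: "proj {vT, vx} ?w' = replicate d vx @ vT # replicate e vx"
    using x' T'(2) proj_insert_notin[of vT p' "{vx}"] proj_insert_notin[of vT q' "{vx}"] by simp
  have nT: "proj X ?w' = proj X w'" if "vT \<notin> X" for X
    using that unfolding w' by simp
  have ps_notin: "proj X ?w = proj X w" if "vT \<notin> X" for X
    using that unfolding w by simp
  \<comment> \<open>The words \<open>u\<close> and \<open>v\<close> use up all letters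
    \<open>a\<close>, so what remains between them is the full power of \<open>vx\<close>.\<close>
  have rest: "r = replicate m vx"
    if r: "proj {vx, a} w' = u @ r @ v" "proj {a} w' = u @ v" "vx \<notin> set u" "vx \<notin> set v" "a \<noteq> vx" for a u r v
  proof -
    have "proj {a} (proj {vx, a} w') = u @ v" "proj {vx} (proj {vx, a} w') = replicate m vx"
      using r(2) \<open>proj {vx} w' = replicate m vx\<close>
      by (simp_all only: proj_proj[of "{a}" "{vx, a}"] proj_proj[of "{vx}" "{vx, a}"] subset_insertI insert_subset empty_subsetI insertI1 simp_thms)
    then have "proj {a} u @ proj {a} r @ proj {a} v = u @ v" "proj {vx} r = replicate m vx"
      unfolding r(1) using r(3,4) by simp_all
    moreover have "set (u @ r @ v) \<subseteq> {vx, a}" unfolding r(1)[symmetric] by auto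
    then have "proj {a} u = u" "proj {a} v = v" using r(3,4) by (auto simp: filter_id_conv)
    ultimately have "proj {a} r = []" by simp
    then have "proj {vx} r = r"
      using \<open>set (u @ r @ v) \<subseteq> {vx, a}\<close> by (auto simp: filter_id_conv filter_empty_conv)
    then show ?thesis using \<open>proj {vx} r = replicate m vx\<close> by simp
  qed
  show "\<nexists>r. proj {vx, vy} w' = [vy, vy] @ r"
  proof
    assume "\<exists>r. proj {vx, vy} w' = [vy, vy] @ r"
    then obtain r where r: "proj {vx, vy} w' = [vy, vy] @ r" by blast
    have "proj {vy} w' = [vy, vy]"
      unfolding w' filter_append sub1[of vy p' vt1] sub1[of vy q' vt1] y' by simp
    then have r': "proj {vx, vy} w' = [vy, vy] @ replicate m vx"
      using rest[of vy "[vy, vy]" r "[]"] r by simp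
    let ?Z = "[vy, vt1, vy] @ replicate d vx @ [vT] @ replicate e vx"
    let ?A = "{vT, vx, vy, vt1}"
    \<comment> \<open>Every adjacent pair of \<open>?Z\<close> is covered by one of three known
      projections: to \<open>vy\<close>, \<open>vt1\<close>, to \<open>vx\<close>,
      \<open>vy\<close>, and to \<open>vT\<close>, \<open>vx\<close>. Only the middle one depends on
      the assumption to be refuted.\<close>
    have "proj ?A ?w' = ?Z"
    proof (rule eq_if_adjacent_proj_eq)
      define R where "R = (\<lambda>c d. \<exists>X. c \<in> X \<and> d \<in> X \<and> proj X ?Z = proj X (proj ?A ?w'))"
      have RI: "R a b" if "proj X ?Z = proj X ?w'" "a \<in> X" "b \<in> X" "X \<subseteq> ?A" for a b X
        unfolding R_def proj_proj[OF that(4), symmetric] using that proj_proj[OF that(4), of ?w'] by metis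
      have "R vy vt1" "R vt1 vy"
        by (rule RI[of "{vy, vt1}"]; use y' in simp)+
      moreover have "proj {vx, vy} ?w' = [vy, vy] @ replicate m vx"
        using nT[of "{vx, vy}"] r' by simp
      then have "proj {vx, vy} ?Z = proj {vx, vy} ?w'"
        unfolding de[symmetric] replicate_add by simp
      then have "R vy vx" by (rule RI) simp_all
      moreover have "R vx vx" "R vx vT" "R vT vx"
        by (rule RI[of "{vT, vx}"]; use xT in simp)+
      ultimately show "successively (\<lambda>c d. \<exists>X. c \<in> X \<and> d \<in> X \<and> proj X ?Z = proj X (proj ?A ?w')) ?Z"
        unfolding R_def[symmetric] using d0 e0
        by (simp add: successively_Cons successively_append_iff successively_replicate hd_append)
      show "set (proj ?A ?w') \<subseteq> set ?Z" using d0 e0 by auto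
    qed simp
    moreover have "isoterm S ?Z" using L[of vy vt1 vx vT d e] d0 e0 de by simp
    ultimately have "proj ?A ?w = ?Z"
      using isoterm_proj_right[OF sat', of ?A] by simp
    then have "proj {vx, vy} (proj ?A ?w) = [vy, vy] @ replicate d vx @ replicate e vx"
      by (simp only:) simp
    moreover have "proj {vx, vy} (proj ?A ?w) = proj {vx, vy} ?w"
      by (rule proj_proj) simp
    moreover have "proj {vx, vy} ?w = proj {vx, vy} w"
      by (rule ps_notin) simp
    ultimately have "proj {vx, vy} w = [vy, vy] @ replicate d vx @ replicate e vx"
      by (simp only: append_assoc)
    then show False using Iy by blast
  qed
  show "\<nexists>r. proj {vx, vz} w' = r @ [vz, vz]"
  proof
    assume "\<exists>r. proj {vx, vz} w' = r @ [vz, vz]"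
    then obtain r where r: "proj {vx, vz} w' = r @ [vz, vz]" by blast
    have "proj {vz} w' = [vz, vz]"
      unfolding w' filter_append sub1[of vz p' vt2] sub1[of vz q' vt2] z' by simp
    then have r': "proj {vx, vz} w' = replicate m vx @ [vz, vz]"
      using rest[of vz "[]" r "[vz, vz]"] r by simp
    let ?Z = "replicate d vx @ [vT] @ replicate e vx @ [vz, vt2, vz]"
    let ?A = "{vT, vx, vz, vt2}"
    have "proj ?A ?w' = ?Z"
    proof (rule eq_if_adjacent_proj_eq)
      define R where "R = (\<lambda>c d. \<exists>X. c \<in> X \<and> d \<in> X \<and> proj X ?Z = proj X (proj ?A ?w'))"
      have RI: "R a b" if "proj X ?Z = proj X ?w'" "a \<in> X" "b \<in> X" "X \<subseteq> ?A" for a b X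
        unfolding R_def proj_proj[OF that(4), symmetric] using that proj_proj[OF that(4), of ?w'] by metis
      have "R vz vt2" "R vt2 vz"
        by (rule RI[of "{vz, vt2}"]; use z' in simp)+
      moreover have "proj {vx, vz} ?w' = replicate m vx @ [vz, vz]"
        using nT[of "{vx, vz}"] r' by simp
      then have "proj {vx, vz} ?Z = proj {vx, vz} ?w'"
        unfolding de[symmetric] replicate_add by simp
      then have "R vx vz" by (rule RI) simp_all
      moreover have "R vx vx" "R vx vT" "R vT vx"
        by (rule RI[of "{vT, vx}"]; use xT in simp)+
      ultimately show "successively (\<lambda>c d. \<exists>X. c \<in> X \<and> d \<in> X \<and> proj X ?Z = proj X (proj ?A ?w')) ?Z"
        unfolding R_def[symmetric] using d0 e0
        by (simp add: successively_Cons successively_append_iff successively_replicate hd_append)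
      show "set (proj ?A ?w') \<subseteq> set ?Z" using d0 e0 by auto
    qed simp
    moreover have "isoterm S ?Z" using M[of vz vT vx vt2 d e] d0 e0 de by simp
    ultimately have "proj ?A ?w = ?Z"
      using isoterm_proj_right[OF sat', of ?A] by simp
    then have "proj {vx, vz} (proj ?A ?w) = replicate d vx @ replicate e vx @ [vz, vz]"
      by (simp only:) simp
    moreover have "proj {vx, vz} (proj ?A ?w) = proj {vx, vz} ?w"
      by (rule proj_proj) simp
    moreover have "proj {vx, vz} ?w = proj {vx, vz} w"
      by (rule ps_notin) simp
    ultimately have "proj {vx, vz} w = (replicate d vx @ replicate e vx) @ [vz, vz]"
      by (simp only: append_assoc)
    then show False using Iz by blast
  qed
qed

lemma not_finitely_based_case8:
  fixes S :: "'a::monoid_mult itself"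
  assumes m: "m > 2" and hyp: "hyp S (W8 m) (U8 m) (V8 m)"
  shows "\<not> finitely_based S"
proof (rule not_finitely_based_if_invariant[where U = "U8 m" and V = "V8 m" and k = "m + 2"
      and I = "\<lambda>n w. proj {vx} w = replicate m vx \<and> (\<nexists>r. proj {vx, vy} w = [vy, vy] @ r) \<and> (\<nexists>r. proj {vx, vz} w = r @ [vz, vz])"])
  obtain k where k: "m = Suc (Suc k)" using m by (cases m; cases "m - 1") auto
  fix n
  have "proj {vx} (U8 m n) = replicate m vx"
    by (simp add: U8_def k filter_blocks_none replicate_append_same)
  moreover have "proj {vx, vy} (U8 m n) = [vy, vx] @ replicate k vx @ [vy, vx]"
    by (simp add: U8_def k filter_blocks_none)
  moreover have "proj {vx, vz} (U8 m n) = replicate (Suc k) vx @ [vz, vx, vz]"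
    by (simp add: U8_def k filter_blocks_none)
  ultimately show "proj {vx} (U8 m n) = replicate m vx \<and> (\<nexists>r. proj {vx, vy} (U8 m n) = [vy, vy] @ r)
      \<and> (\<nexists>r. proj {vx, vz} (U8 m n) = r @ [vz, vz])"
    by (simp del: replicate.simps)
  have "proj {vx, vz} (V8 m n) = replicate m vx @ [vz, vz]"
    by (simp add: V8_def filter_blocks_none)
  then show "\<not> (proj {vx} (V8 m n) = replicate m vx \<and> (\<nexists>r. proj {vx, vy} (V8 m n) = [vy, vy] @ r)
      \<and> (\<nexists>r. proj {vx, vz} (V8 m n) = r @ [vz, vz]))"
    by blast
next
  fix \<Sigma> N n w w'
  assume bas: "basis S \<Sigma> N" and n: "N + (m + 2) < n" "1 < n" and sat: "satisfies S (U8 m n) w"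
    and I: "proj {vx} w = replicate m vx \<and> (\<nexists>r. proj {vx, vy} w = [vy, vy] @ r) \<and> (\<nexists>r. proj {vx, vz} w = r @ [vz, vz])"
    and step: "ded_step \<Sigma> w w'"
  have W: "\<forall>w\<in>W8 m. isoterm S w" using hyp by (simp add: hyp_def)
  show "proj {vx} w' = replicate m vx \<and> (\<nexists>r. proj {vx, vy} w' = [vy, vy] @ r) \<and> (\<nexists>r. proj {vx, vz} w' = r @ [vz, vz])"
    using case8_step[OF m W bas n sat _ _ _ step] I by (elim conjE) (intro conjI)
qed (use hyp in \<open>simp_all add: hyp_def U8_def V8_def\<close>)

section \<open>Case 2\<close>

lemma distinct_if_proj:
  assumes "\<And>a. a \<in> set w \<Longrightarrow> proj {a} w = [a]"
  shows "distinct w"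
proof (rule ccontr)
  assume "\<not> distinct w"
  then obtain u v z a where "w = u @ [a] @ v @ [a] @ z" using not_distinct_decomp by blast
  then show False using assms[of a] by (auto simp: append_eq_Cons_conv)
qed

lemma card_adjs_distinct:
  assumes "distinct w"
  shows "card (adjs w) \<ge> length w - 1"
proof -
  let ?f = "\<lambda>i. (w ! i, w ! Suc i)"
  have "card (?f ` {..<length w - 1}) = length w - 1"
    by (subst card_image) (auto simp: inj_on_def nth_eq_iff_index_eq assms)
  moreover have "?f ` {..<length w - 1} \<subseteq> adjs w"
  proof (rule image_subsetI)
    fix i assume "i \<in> {..<length w - 1}"
    then have "i < length w" "Suc i < length w" by auto
    then have "w = take i w @ w ! i # w ! Suc i # drop (Suc (Suc i)) w"
      by (metis Cons_nth_drop_Suc append_take_drop_id)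
    then show "?f i \<in> adjs w" by (rule adjsI)
  qed
  ultimately show ?thesis using card_mono[OF finite_adjs] by metis
qed

text \<open>After the last linear letter \<open>t\<close> come both \<open>vx\<close>, both
  \<open>vy\<close> and one copy of each \<open>zs i\<close>, in an order that is only partly known.
  Cutting between two \<open>zs\<close> there puts both \<open>vx\<close> on the left and a
  \<open>vy\<close> on the right, so the invariant \<open>y x x y\<close> becomes the isoterm
  \<open>y x x T y\<close>.\<close>

lemma case2_step:
  fixes S :: "'a::monoid_mult itself"
  assumes W: "\<forall>w\<in>W2. isoterm S w"
    and bas: "basis S \<Sigma> N" and n: "N + 6 < n" "1 < n" and sat: "satisfies S (U2 n) w"
    and I: "proj {vx, vy} w = [vy, vx, vx, vy]" and step: "ded_step \<Sigma> w w'"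
  shows "proj {vx, vy} w' = [vy, vx, vx, vy]"
proof -
  have yxxty: "isoterm S [y, x, x, t, y]" if "distinct [x, y, t]" for x y t
    using W isoterm_rename[of S "[vy, vx, vx, vt, vy]" "[vx, vy, vt]" "[x, y, t]"] that
    by (simp add: W2_def)
  have ytxxy: "isoterm S [y, t, x, x, y]" if "distinct [x, y, t]" for x y t
    using W isoterm_rename[of S "[vy, vt, vx, vx, vy]" "[vx, vy, vt]" "[x, y, t]"] that
    by (simp add: W2_def)
  have xtx: "iso_xtx S"
    by (rule iso_xtxI[of S vy "[vt, vx, vx]"]) (use ytxxy in auto)
  note lin = lin_if_xtx[OF xtx]
  have txx: "isoterm S [t, x, x]" if "t \<noteq> x" for t x
  proof -
    obtain y where "y \<notin> {t, x}" using ex_new_if_finite[of "{t, x}"] by auto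
    then show ?thesis using isoterm_factor[of S "[y]" "[t, x, x]" "[y]"] ytxxy[of x y t] that by auto
  qed
  let ?b = "\<lambda>i. [zs i, ts i]"
  note s = U2_def up_def proj_simps filter_blocks_none
  \<comment> \<open>This letter separates the first occurrences of all \<open>zs i\<close> from the
    second ones, and isoterms containing it determine what lies in \<open>H\<close> and in
    \<open>M\<close>.\<close>
  define t where "t = ts n"
  have tw: "proj {t} w = [t]"
    using isoterm_proj[OF sat, of "{t}"] n lin
    by (simp add: s t_def filter_blocks_single[of n n] lin_def)
  then have "t \<in> set w" using filter_empty_conv by force
  then obtain H M where w: "w = H @ t # M" and tH: "t \<notin> set H" by (meson split_list_first)
  have tM: "t \<notin> set M" using tw tH unfolding w by (auto simp: filter_empty_conv)
  have split: "proj X H = u \<and> proj X M = v" if "proj (insert t X) w = u @ t # v" "t \<notin> set u" "t \<notin> set v" for X u v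
    using proj_split[OF that(1)[unfolded w] insertI1 that(2,3)]
    by (simp only: proj_insert_notin[OF tH] proj_insert_notin[OF tM])
  have zHM: "proj {zs i} H = [zs i] \<and> proj {zs i} M = [zs i]" if i: "1 \<le> i" "i \<le> n" for i
  proof (rule split)
    show "proj {t, zs i} w = [zs i] @ t # [zs i]"
      using isoterm_proj[OF sat, of "{t, zs i}"] i isoterm_xtx[OF xtx]
      by (cases "i = n") (simp_all add: s t_def filter_blocks_single[of n n] filter_blocks_two[of i n n])
  qed (simp_all add: t_def)
  \<comment> \<open>By the pattern \<open>ytxxy\<close> with \<open>zs i\<close> as the outer
    letter, both \<open>vx\<close> precede every \<open>zs i\<close> in \<open>M\<close>.\<close>
  have xzM: "proj {vx, zs i} M = [vx, vx, zs i]" if i: "1 \<le> i" "i \<le> n" for i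
  proof -
    have "proj {t, vx, zs i} w = [zs i] @ t # [vx, vx, zs i]"
      using isoterm_proj[OF sat, of "{t, vx, zs i}"] i ytxxy
      by (cases "i = n") (simp_all add: s t_def filter_blocks_single[of n n] filter_blocks_two[of i n n])
    from split[OF this] show ?thesis by (simp add: t_def)
  qed
  have yM: "proj {vy} H = [] \<and> proj {vy} M = [vy, vy]"
  proof (rule split)
    show "proj {t, vy} w = [] @ t # [vy, vy]"
      using isoterm_proj[OF sat, of "{t, vy}"] n txx
      by (simp add: s t_def filter_blocks_single[of n n])
  qed (simp_all add: t_def)
  have tiM: "ts i \<notin> set M" if i: "1 \<le> i" "i < n" for i
  proof -
    have "proj {t, ts i} w = [ts i] @ t # []"
      using isoterm_proj[OF sat, of "{t, ts i}"] i isoterm_ts[OF xtx]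
      by (simp add: s t_def filter_blocks_two[of i n n])
    from split[OF this] show ?thesis using i by (auto simp: t_def filter_empty_conv)
  qed
  have zt: "proj {zs k, ts k} H = [zs k, ts k]" if k: "1 \<le> k" "k < n" for k
  proof -
    have "proj {zs k, ts k} w = [zs k, ts k, zs k]"
      using isoterm_proj[OF sat, of "{zs k, ts k}"] k isoterm_xtx[OF xtx]
      by (simp add: s filter_blocks_single[of k n])
    moreover have "proj {zs k, ts k} M = proj {zs k} M"
      using tiM[OF k] by (auto intro!: filter_cong)
    moreover have "proj {zs k, ts k} w = proj {zs k, ts k} H @ proj {zs k, ts k} M"
      unfolding w using k by (simp add: t_def)
    ultimately show ?thesis using zHM[of k] k by simp
  qed
  have tz: "proj {ts k, zs l} H = [ts k, zs l]" if k: "1 \<le> k" "k < l" "l \<le> n" for k l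
  proof -
    have "proj {ts k, zs l} w = [ts k, zs l, zs l]"
      using isoterm_proj[OF sat, of "{ts k, zs l}"] k txx
      by (simp add: s filter_blocks_two[of k l n])
    moreover have "proj {ts k, zs l} M = proj {zs l} M"
      using tiM[of k] k by (auto intro!: filter_cong)
    moreover have "proj {ts k, zs l} w = proj {ts k, zs l} H @ proj {ts k, zs l} M"
      unfolding w using k by (simp add: t_def)
    ultimately show ?thesis using zHM[of l] k by simp
  qed
  \<comment> \<open>With \<open>k\<close> the smaller and \<open>l\<close> the larger index,
    \<open>ts k\<close> lies after \<open>zs k\<close> and before \<open>zs l\<close> in
    \<open>H\<close>, so the two letters are never adjacent there, in either order.\<close>
  have notH: False if H: "H = p @ zs i # zs j # r" and ij: "1 \<le> i" "i \<le> n" "1 \<le> j" "j \<le> n" "i \<noteq> j" for p r i j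
  proof -
    have "ts k \<notin> set p \<and> ts k \<in> set p" if k: "k = min i j" "l = max i j" for k l
    proof
      have kl: "1 \<le> k" "k < n" "k < l" "l \<le> n" using ij k by auto
      have "{i, j} = {k, l}" using k by (auto simp: min_def max_def)
      then have or: "(i = k \<and> j = l) \<or> (i = l \<and> j = k)" by (auto simp: doubleton_eq_iff)
      have "proj {zs k, ts k} p @ zs k # proj {zs k, ts k} r = [zs k, ts k]"
        using zt[OF kl(1,2)] or kl(3) unfolding H by auto
      then show "ts k \<notin> set p" by (auto simp: append_eq_Cons_conv filter_empty_conv)
      have "proj {ts k, zs l} p @ zs l # proj {ts k, zs l} r = [ts k, zs l]"
        using tz[OF kl(1,3,4)] or kl(3) unfolding H by auto
      then have "ts k \<in> set (proj {ts k, zs l} p)" by (auto simp: append_eq_Cons_conv simp del: set_filter)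
      then show "ts k \<in> set p" by simp
    qed
    then show False by blast
  qed
  \<comment> \<open>The order of the \<open>zs\<close> in \<open>M\<close> is not known, so the
    factors are the adjacent pairs of whichever permutation \<open>?Z\<close> occurs; the two
    \<open>vx\<close> and two \<open>vy\<close> break at most four of them.\<close>
  let ?Q = "\<lambda>v. v \<noteq> vx \<and> v \<noteq> vy"
  let ?Z = "filter ?Q M"
  have setM: "set M \<subseteq> {vx, vy} \<union> zs ` {1..n}"
  proof
    fix a assume a: "a \<in> set M"
    then have "a \<in> set (U2 n)" using satisfies_set[OF lin sat] unfolding w by auto
    then have "a \<in> {vx, vy} \<union> zs ` {1..n} \<union> ts ` {1..n}"
      by (auto simp: U2_def up_def blocks_def)
    moreover have "a \<noteq> ts i" if "i \<in> {1..n}" for i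
      using tiM[of i] tM a that by (cases "i = n") (auto simp: t_def)
    ultimately show "a \<in> {vx, vy} \<union> zs ` {1..n}" by blast
  qed
  have setZ: "set ?Z = zs ` {1..n}"
  proof
    show "zs ` {1..n} \<subseteq> set ?Z"
    proof (rule image_subsetI)
      fix i assume "i \<in> {1..n}"
      then have "proj {zs i} M \<noteq> []" using zHM[of i] by simp
      then show "zs i \<in> set ?Z" by (auto simp: filter_empty_conv)
    qed
  qed (use setM in auto)
  have dist: "distinct ?Z"
  proof (rule distinct_if_proj)
    fix a assume "a \<in> set ?Z"
    then obtain i where "1 \<le> i" "i \<le> n" "a = zs i" unfolding setZ by auto
    moreover have "proj {zs i} ?Z = proj {zs i} M" by (auto intro!: filter_cong)
    ultimately show "proj {a} ?Z = [a]" using zHM by simp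
  qed
  have "length ?Z = n"
    using distinct_card[OF dist] unfolding setZ by (simp add: card_image inj_on_def)
  then have cardZ: "n - 1 \<le> card (adjs ?Z)" using card_adjs_distinct[OF dist] by simp
  have "length (filter (\<lambda>v. \<not> ?Q v) M) \<le> 4"
  proof -
    have "filter (\<lambda>v. \<not> ?Q v) M = proj {vx, vy} M" by (auto intro!: filter_cong)
    moreover have "length (proj {vx, vy} M) \<le> length (proj {vx, vy} w)" unfolding w by simp
    ultimately show ?thesis using I by simp
  qed
  then have "card (adjs ?Z) \<le> card (adjs ?Z \<inter> adjs M) + 4"
    by (intro card_Int_adjs) auto
  then have card: "Suc N < card (adjs ?Z \<inter> adjs M)" using cardZ n by linarith
  have pairs: "\<exists>i j. 1 \<le> i \<and> i \<le> n \<and> 1 \<le> j \<and> j \<le> n \<and> i \<noteq> j \<and> c = zs i \<and> d = zs j"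
    if cd: "(c, d) \<in> adjs ?Z" for c d
  proof -
    obtain p q where pq: "?Z = p @ c # d # q" using cd unfolding adjs_def by blast
    then have "c \<in> set ?Z" "d \<in> set ?Z" by (simp_all del: set_filter)
    moreover have "c \<noteq> d" using dist unfolding pq by simp
    ultimately show ?thesis unfolding setZ by auto
  qed
  have position: "\<exists>p'. p = H @ t # p' \<and> M = p' @ c # d # q"
    if cd: "(c, d) \<in> adjs ?Z" and pq: "w = p @ c # d # q" for c d p q
  proof -
    obtain i j where ij: "1 \<le> i" "i \<le> n" "1 \<le> j" "j \<le> n" "i \<noteq> j" "c = zs i" "d = zs j"
      using pairs[OF cd] by blast
    have "H @ t # M = p @ c # d # q" "c \<noteq> t" "d \<noteq> t"
      using pq w ij by (simp_all add: t_def)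
    then consider r where "H = p @ c # d # r" | p' where "p = H @ t # p'" "M = p' @ c # d # q"
      by (auto simp: append_eq_append_conv2 Cons_eq_append_conv append_eq_Cons_conv)
    then show ?thesis using notH ij by cases blast+
  qed
  have notin: "c \<notin> set p" "c \<notin> set q"
    if "M = p @ c # q" "c = zs i" "1 \<le> i" "i \<le> n" for c p q i
    using zHM[OF that(3,4)] that(1,2) by (auto simp: append_eq_Cons_conv filter_empty_conv)
  have once: "once w c d" if cd: "(c, d) \<in> adjs ?Z \<inter> adjs M" for c d
    unfolding once_def
  proof (intro conjI allI impI)
    obtain p q where "M = p @ c # d # q" using cd unfolding adjs_def by blast
    then have "w = (H @ t # p) @ c # d # q" unfolding w by simp
    then show "\<exists>p q. w = p @ c # d # q" by (intro exI)
    fix p q p' q' assume eq: "w = p @ c # d # q" "w = p' @ c # d # q'"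
    have cd': "(c, d) \<in> adjs ?Z" using cd by (rule IntD1)
    obtain p1 p2 where *: "p = H @ t # p1" "M = p1 @ c # d # q" "p' = H @ t # p2" "M = p2 @ c # d # q'"
      using position[OF cd' eq(1)] position[OF cd' eq(2)] by (elim exE conjE)
    obtain i where i: "c = zs i" "1 \<le> i" "i \<le> n" using pairs[OF cd'] by (elim exE conjE)
    have "p1 @ c # d # q = p2 @ c # d # q'" using *(2,4) by simp
    then have "p1 = p2"
      using append_Cons_eq_iff[of c p1 "d # q" p2 "d # q'"] notin[OF *(2) i] by simp
    then show "p = p'" using * by simp
  qed
  obtain c d p q p' q' where *: "(c, d) \<in> adjs ?Z \<inter> adjs M" "w = p @ c # d # q" "w' = p' @ q'"
      "ded_step \<Sigma> (p @ c # vT # d # q) (p' @ vT # q')"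
    using ded_step_insert[OF bas lin step card once] .
  obtain i j where ij: "1 \<le> i" "i \<le> n" "1 \<le> j" "j \<le> n" "i \<noteq> j" "c = zs i" "d = zs j"
    using pairs[OF IntD1[OF *(1)]] by (elim exE conjE)
  obtain p2 where p2: "p = H @ t # p2" "M = p2 @ c # d # q"
    using position[OF IntD1[OF *(1)] *(2)] by (elim exE conjE)
  have "proj {vx, zs i} p2 @ zs i # proj {vx, zs i} q = [vx, vx, zs i]"
    using xzM[OF ij(1,2)] ij(5-7) unfolding p2(2) by simp
  then have xq: "vx \<notin> set q" by (auto simp: append_eq_Cons_conv filter_empty_conv)
  \<comment> \<open>If both \<open>vy\<close> preceded \<open>zs j\<close> in \<open>M\<close>, the
    projection \<open>zs j t vy vy zs j\<close> would be an isoterm, but in \<open>U2 n\<close> the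
    last \<open>vy\<close> follows \<open>zs j\<close>.\<close>
  have yq: "vy \<in> set q"
  proof (rule ccontr)
    assume "vy \<notin> set q"
    moreover have "M = (p2 @ [c]) @ d # q" using p2(2) by simp
    then have "zs j \<notin> set (p2 @ [c])" "zs j \<notin> set q"
      using notin[of "p2 @ [c]" d q j] ij by simp_all
    ultimately have "proj {vy, zs j} (p2 @ [c]) = proj {vy} (p2 @ [c])" "proj {vy, zs j} q = []"
      "proj {vy} q = []"
      by (auto simp: filter_empty_conv intro!: filter_cong)
    then have "proj {vy, zs j} M = [vy, vy, zs j]"
      using yM ij(7) unfolding \<open>M = (p2 @ [c]) @ d # q\<close> filter_append by simp
    moreover have "vy \<notin> set H" using yM by (auto simp: filter_empty_conv)
    then have "proj {vy, zs j} H = proj {zs j} H" by (auto intro!: filter_cong)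
    ultimately have "proj {t, vy, zs j} w = [zs j, t, vy, vy, zs j]"
      using zHM[OF ij(3,4)] tH tM proj_insert_notin[of t _ "{vy, zs j}"] unfolding w by simp
    then have "proj {t, vy, zs j} (U2 n) = [zs j, t, vy, vy, zs j]"
      using isoterm_proj_right[OF sat, of "{t, vy, zs j}"] ytxxy[of vy "zs j" t] by (simp add: t_def)
    then show False
      using ij(3,4) by (cases "j = n") (simp_all add: s t_def filter_blocks_single[of n n] filter_blocks_two[of j n n])
  qed
  have pq: "proj {vx, vy} p @ proj {vx, vy} q = [vy, vx] @ [vx, vy]"
    using I ij(6,7) unfolding *(2) by simp
  have ne: "proj {vx, vy} q \<noteq> []" "vx \<notin> set (proj {vx, vy} q)"
    using xq yq by (auto simp: filter_empty_conv)
  have p1: "proj {vx, vy} p = [vy, vx, vx]" and q1: "proj {vx, vy} q = [vy]"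
    using append_eq_snoc2[OF pq ne] by simp_all
  have T: "vT \<notin> set w" by (rule lin_notin[OF lin sat]) (auto simp: U2_def up_def blocks_def)
  then have T: "vT \<notin> set (p @ c # d # q)" "vT \<notin> set (p' @ q')"
    using lin_notin[OF lin ded_step_satisfies[OF bas step]] *(2,3) by simp_all
  have iso: "isoterm S ([vy, vx, vx] @ vT # [vy])" using yxxty by simp
  have "proj {vx, vy} p' = [vy, vx, vx]" "proj {vx, vy} q' = [vy]"
    by (rule isoterm_proj_step[OF bas *(4) T iso]; use p1 q1 ij(6,7) in simp)+
  then show ?thesis unfolding *(3) by simp
qed

lemma not_finitely_based_case2:
  fixes S :: "'a::monoid_mult itself"
  assumes "hyp S W2 U2 V2"
  shows "\<not> finitely_based S"
proof (rule not_finitely_based_if_invariant[where U = U2 and V = V2 and k = 6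
      and I = "\<lambda>n w. proj {vx, vy} w = [vy, vx, vx, vy]"])
  show "proj {vx, vy} (U2 n) = [vy, vx, vx, vy]" "proj {vx, vy} (V2 n) \<noteq> [vy, vx, vx, vy]" for n
    by (simp_all add: U2_def V2_def up_def proj_simps filter_blocks_none)
next
  fix \<Sigma> N n w w'
  assume "basis S \<Sigma> N" "N + 6 < n" "1 < n" "satisfies S (U2 n) w"
    "proj {vx, vy} w = [vy, vx, vx, vy]" "ded_step \<Sigma> w w'"
  then show "proj {vx, vy} w' = [vy, vx, vx, vy]"
    using case2_step assms unfolding hyp_def by blast
qed (use assms in \<open>simp_all add: hyp_def U2_def V2_def\<close>)

theorem theorem4p4:
  fixes S :: "'a::monoid_mult itself"
  shows "(hyp S W1 U1 V1 \<longrightarrow> \<not> finitely_based S)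
       \<and> (hyp S W2 U2 V2 \<longrightarrow> \<not> finitely_based S)
       \<and> (hyp S W3 U3 V3 \<longrightarrow> \<not> finitely_based S)
       \<and> (hyp S W4 U4 V4 \<longrightarrow> \<not> finitely_based S)
       \<and> (hyp S W56 U5 V5 \<longrightarrow> \<not> finitely_based S)
       \<and> (hyp S W56 U6 V6 \<longrightarrow> \<not> finitely_based S)
       \<and> (hyp S W7 U7 V7 \<longrightarrow> \<not> finitely_based S)
       \<and> (\<forall>m::nat. m > 2 \<longrightarrow> hyp S (W8 m) (U8 m) (V8 m) \<longrightarrow> \<not> finitely_based S)"
  using not_finitely_based_case1 not_finitely_based_case2 not_finitely_based_case3 not_finitely_based_case4 not_finitely_based_case5 not_finitely_based_case6 not_finitely_based_case7 not_finitely_based_case8 by blast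

end
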